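(* Let $1\le m\le n-2$, let $V^{n-1}$ be an $m$-canal hypersurface of the conformal space $C^n$, and let $U^n$ be the hypersurface of the projective space $P^{n+1}$ that is the image of $V^{n-1}$ under the Darboux mapping. Then $U^n$ is a tangentially degenerate hypersurface of rank $r=n-m-1$ with $(m+1)$-dimensional plane generators.
   Context: Everything is real and smooth, and considered locally. **Darboux mapping.** The $n$-dimensional conformal space $C^n$ is described by polyspherical coordinates: let $E$ be an $(n+2)$-dimensional real vector space with a symmetric bilinear form $(\cdot,\cdot)$ of signature $(n+1,1)$, and let $P^{n+1}=P(E)$. Points of $C^n$ are identified with the points of the oval hyperquadric $Q^n=\{[X]:(X,X)=0\}\subset P^{n+1}$ (the Darboux hyperquadric), and hyperspheres of $C^n$ are identified with the points $[X]\in P^{n+1}$ with $(X,X)>0$, i.e. lying outside $Q^n$. A point $[Y]\in Q^n$ lies on the hypersphere $[X]$ iff $(X,Y)=0$. This identification is the Darboux mapping. The polar hyperplane of $x=[X]$ with respect to $Q^n$ is $\xi=\{[Z]:(Z,X)=0\}$; for a hypersphere $x$, the hyperplane $\xi$ meets $Q^n$ exactly in the images of the points of that hypersphere. **Canal hypersurfaces.** A hypersurface $V^{n-1}\subset C^n$ is an *$m$-canal hypersurface* if it is the envelope of an $r$-parameter differentiable family of hyperspheres, $r=n-m-1$; it then carries an $r$-parameter family of $m$-dimensional spherical characteristics $S^m$, along which the hyperspheres of the family are tangent to it. **The image $U^n$.** Let $V^{n-1}$ be the envelope of an $r$-parameter family of hyperspheres. Under the Darboux mapping the hyperspheres of this family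 become points $x$ describing an $r$-dimensional submanifold $U^r\subset P^{n+1}$ outside $Q^n$. The hypersurface $U^n\subset P^{n+1}$ called the image of $V^{n-1}$ under the Darboux mapping is the envelope of the $r$-parameter family of polar hyperplanes $\xi$ of the points $x\in U^r$: if $U^r$ is locally parametrized by $X(u)\in E$, $u=(u^1,\dots,u^r)$, then $U^n$ consists of the points $[Z]$ for which there is a $u$ with $(Z,X(u))=0$ and $(Z,\partial X/\partial u^\alpha(u))=0$ for $\alpha=1,\dots,r$. Statements about the tangent hyperplanes of $U^n$ refer to its regular points. **Tangential degeneracy.** A hypersurface $U^n\subset P^{n+1}$ is *tangentially degenerate of rank $r$* ($r<n$) if its tangent hyperplanes depend on exactly $r$ parameters, i.e. its Gauss map, assigning to a point of $U^n$ its tangent hyperplane, has rank $r$. Its *plane generators* are the projective subspaces ("planes") of dimension $n-r$ lying on $U^n$ along each of which the tangent hyperplane to $U^n$ is constant. *)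

theory Defs
  imports "HOL-Analysis.Analysis"
begin

text \<open>
  Conventions.  The vector space \<open>E\<close> is a type of class \<open>euclidean_space\<close>; its class inner product
  plays no geometric role (it only names covectors), the geometry is carried by the Lorentzian
  form \<open>B\<close>.  A set of points of the projective space \<open>P(E)\<close> is represented by the cone of all
  nonzero representatives of its points, and a projective subspace of dimension \<open>k\<close> by a linear
  subspace of dimension \<open>k + 1\<close>.  Hence a \<open>d\<close>-dimensional submanifold of \<open>P(E)\<close> appears as a
  cone of dimension \<open>d + 1\<close>, and its projective tangent space as a linear subspace of
  dimension \<open>d + 1\<close>.
\<close>

primrec Ck_on :: "nat \<Rightarrow> 'a::real_normed_vector set \<Rightarrow> ('a \<Rightarrow> 'b::real_normed_vector) \<Rightarrow> bool" where
  "Ck_on 0 S f \<longleftrightarrow> continuous_on S f"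
| "Ck_on (Suc k) S f \<longleftrightarrow>
     (\<forall>x\<in>S. f differentiable (at x)) \<and> (\<forall>v. Ck_on k S (\<lambda>x. frechet_derivative f (at x) v))"

text \<open>Only meant for open \<open>S\<close>, since the derivatives are unrestricted ones.\<close>

definition smooth_on :: "'a::real_normed_vector set \<Rightarrow> ('a \<Rightarrow> 'b::real_normed_vector) \<Rightarrow> bool" where
  "smooth_on S f \<longleftrightarrow> (\<forall>k. Ck_on k S f)"


section \<open>Regular points, tangent spaces, Gauss map\<close>

text \<open>
  Near \<open>p\<close> the set \<open>M\<close> is an embedded smooth submanifold with tangent space \<open>T\<close>: it is cut out by
  \<open>k\<close> smooth equations, whose differentials at \<open>p\<close> are independent because their common kernel \<open>T\<close>
  has codimension \<open>k\<close>.
\<close>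

definition tangent_space_at :: "'a::euclidean_space set \<Rightarrow> 'a \<Rightarrow> 'a set \<Rightarrow> bool" where
  "tangent_space_at M p T \<longleftrightarrow>
     p \<in> M \<and>
     (\<exists>k N (f :: nat \<Rightarrow> 'a \<Rightarrow> real).
        open N \<and> p \<in> N \<and> (\<forall>i<k. smooth_on N (f i)) \<and>
        M \<inter> N = {x \<in> N. \<forall>i<k. f i x = 0} \<and>
        T = {w. \<forall>i<k. frechet_derivative (f i) (at p) w = 0} \<and>
        dim T + k = DIM('a))"

definition regular_points :: "nat \<Rightarrow> 'a::euclidean_space set \<Rightarrow> 'a set" where
  "regular_points d M = {p. \<exists>T. tangent_space_at M p T \<and> dim T = d}"

text \<open>The regular points of a hypersurface of \<open>P(E)\<close>, whose cone has dimension \<open>DIM('a) - 1\<close>.\<close>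

definition hypersurface_points :: "'a::euclidean_space set \<Rightarrow> 'a set" where
  "hypersurface_points U = regular_points (DIM('a) - 1) U"

text \<open>
  The Gauss map of a hypersurface \<open>U\<close> sends a regular point to the class \<open>[\<nu>]\<close> of the covectors
  \<open>\<lambda>w. \<nu> \<bullet> w\<close> whose kernel is the tangent hyperplane.  If \<open>\<nu>\<close> is a smooth local lift of this map
  into \<open>P(E\<^sup>*)\<close>, its differential at \<open>p\<close> is the differential of \<open>\<nu>\<close> on the tangent space taken modulo
  \<open>\<nu> p\<close>, so its rank is one less than the dimension of the span of \<open>\<nu> p\<close> and of the derivatives
  of \<open>\<nu>\<close> in tangent directions.  This number does not depend on the lift.
\<close>

definition gauss_map_rank :: "'a::euclidean_space set \<Rightarrow> 'a \<Rightarrow> nat \<Rightarrow> bool" where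
  "gauss_map_rank U p r \<longleftrightarrow>
     (\<exists>N \<nu>. open N \<and> p \<in> N \<and> p \<in> U \<and> smooth_on N \<nu> \<and>
        (\<forall>q \<in> U \<inter> N. \<nu> q \<noteq> 0 \<and> tangent_space_at U q {w. \<nu> q \<bullet> w = 0}) \<and>
        dim (insert (\<nu> p) (frechet_derivative \<nu> (at p) ` {w. \<nu> p \<bullet> w = 0})) = r + 1)"

text \<open>Here \<open>DIM('a) - 2\<close> is the dimension \<open>n\<close> of a hypersurface of \<open>P(E)\<close>.\<close>

definition tangentially_degenerate :: "'a::euclidean_space set \<Rightarrow> nat \<Rightarrow> bool" where
  "tangentially_degenerate U r \<longleftrightarrow>
     r < DIM('a) - 2 \<and> (\<forall>p \<in> hypersurface_points U. gauss_map_rank U p r)"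

text \<open>A \<open>k\<close>-plane lying on \<open>U\<close> along which the tangent hyperplane at regular points is constant.\<close>

definition plane_generator :: "'a::euclidean_space set \<Rightarrow> nat \<Rightarrow> 'a set \<Rightarrow> bool" where
  "plane_generator U k L \<longleftrightarrow>
     subspace L \<and> dim L = k + 1 \<and> L - {0} \<subseteq> U \<and>
     (\<exists>H. \<forall>p \<in> L \<inter> hypersurface_points U. tangent_space_at U p H)"


section \<open>Conformal space in polyspherical coordinates\<close>

definition has_signature ::
    "('a::euclidean_space \<Rightarrow> 'a \<Rightarrow> real) \<Rightarrow> 'a set \<Rightarrow> nat \<Rightarrow> nat \<Rightarrow> bool" where
  "has_signature B S p q \<longleftrightarrow>
     (\<exists>P N. subspace P \<and> subspace N \<and> S = span (P \<union> N) \<and> dim P = p \<and> dim N = q \<and>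
        (\<forall>x\<in>P. \<forall>y\<in>N. B x y = 0) \<and>
        (\<forall>x\<in>P. x \<noteq> 0 \<longrightarrow> B x x > 0) \<and> (\<forall>y\<in>N. y \<noteq> 0 \<longrightarrow> B y y < 0))"

definition darboux_quadric :: "('a::euclidean_space \<Rightarrow> 'a \<Rightarrow> real) \<Rightarrow> 'a set" where
  "darboux_quadric B = {Y. Y \<noteq> 0 \<and> B Y Y = 0}"

text \<open>
  A smooth family of hyperspheres \<open>[X u]\<close>, \<open>u \<in> D\<close>, with as many parameters as the dimension
  of \<open>'b\<close>: the last condition says that \<open>u \<mapsto> [X u]\<close> is an immersion into \<open>P(E)\<close>.
\<close>

definition hypersphere_family ::
    "('a::euclidean_space \<Rightarrow> 'a \<Rightarrow> real) \<Rightarrow> 'b::euclidean_space set \<Rightarrow> ('b \<Rightarrow> 'a) \<Rightarrow> bool" where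
  "hypersphere_family B D X \<longleftrightarrow>
     open D \<and> D \<noteq> {} \<and> smooth_on D X \<and> (\<forall>u\<in>D. B (X u) (X u) > 0) \<and>
     (\<forall>u\<in>D. \<forall>v c. frechet_derivative X (at u) v = c *\<^sub>R X u \<longrightarrow> v = 0)"

text \<open>
  The intersection of the polar hyperplane of \<open>[X u]\<close> with its infinitely near ones.
\<close>

definition characteristic_plane ::
    "('a::euclidean_space \<Rightarrow> 'a \<Rightarrow> real) \<Rightarrow> ('b::euclidean_space \<Rightarrow> 'a) \<Rightarrow> 'b \<Rightarrow> 'a set" where
  "characteristic_plane B X u =
     {Z. B Z (X u) = 0 \<and> (\<forall>v\<in>Basis. B Z (frechet_derivative X (at u) v) = 0)}"

definition characteristic ::
    "('a::euclidean_space \<Rightarrow> 'a \<Rightarrow> real) \<Rightarrow> ('b::euclidean_space \<Rightarrow> 'a) \<Rightarrow> 'b \<Rightarrow> 'a set" where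
  "characteristic B X u = characteristic_plane B X u \<inter> darboux_quadric B"

text \<open>
  \<open>V\<close> is the hypersurface of the quadric enveloped by the family, with \<open>m\<close>-dimensional
  characteristics.

  The intersection of the quadric with a projective subspace is a real \<open>m\<close>-dimensional sphere iff
  \<open>B\<close> has signature \<open>(m + 1, 1)\<close> on the corresponding linear subspace.

  A hypersurface of the quadric has dimension \<open>n - 1\<close>, so its cone has dimension
  \<open>n = DIM('a) - 2\<close>.  Envelopes may have singular (focal) points, even on every characteristic, so
  only a regular point on each characteristic is required.  This cannot be dropped: a family
  filling a projective subspace satisfies everything else, but all its characteristics coincide
  and it envelopes no hypersurface.

  The tangent space to the hypersphere \<open>X u\<close> at its point \<open>Y\<close> is the space of all \<open>W\<close> orthogonal
  to both \<open>Y\<close> and \<open>X u\<close>; the last condition says that the hypersphere is tangent to \<open>V\<close> along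
  its characteristic.
\<close>

definition canal_hypersurface ::
    "('a::euclidean_space \<Rightarrow> 'a \<Rightarrow> real) \<Rightarrow> nat \<Rightarrow> 'b::euclidean_space set \<Rightarrow> ('b \<Rightarrow> 'a) \<Rightarrow> 'a set \<Rightarrow> bool"
  where
  "canal_hypersurface B m D X V \<longleftrightarrow>
     hypersphere_family B D X \<and>
     V = (\<Union>u\<in>D. characteristic B X u) \<and>
     (\<forall>u\<in>D. has_signature B (characteristic_plane B X u) (m + 1) 1) \<and>
     (\<forall>u\<in>D. characteristic B X u \<inter> regular_points (DIM('a) - 2) V \<noteq> {}) \<and>
     (\<forall>u\<in>D. \<forall>Y\<in>characteristic B X u. \<forall>T.
        tangent_space_at V Y T \<and> dim T = DIM('a) - 2 \<longrightarrow> T = {W. B W Y = 0 \<and> B W (X u) = 0})"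

definition darboux_image ::
    "('a::euclidean_space \<Rightarrow> 'a \<Rightarrow> real) \<Rightarrow> 'b::euclidean_space set \<Rightarrow> ('b \<Rightarrow> 'a) \<Rightarrow> 'a set" where
  "darboux_image B D X = (\<Union>u\<in>D. characteristic_plane B X u) - {0}"

end

theory Submission
  imports Defs
begin

text \<open>
  Write \<open>P u\<close> for the plane \<open>{X, dX}\<^sup>\<bottom>\<close>, of dimension \<open>m + 2\<close>.  At \<open>q \<in> P u\<close> the image is governed by
  the form \<open>B q (ddX u)\<close>: differentiating \<open>B (c s) (X (u s)) = 0\<close> and \<open>B (c s) (dX (u s)) = 0\<close> shows that
  a vector \<open>w\<close> orthogonal to \<open>X u\<close> is the velocity of a curve \<open>c s \<in> P (u + s v)\<close> through \<open>q\<close> iff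
  \<open>B w (dX u) + B q (ddX u v) = 0\<close>.

  At a regular point of \<open>V\<close> on the characteristic the form is nondegenerate: a vector \<open>v\<close> in its kernel
  gives a curve in \<open>V\<close> with zero velocity along which \<open>u\<close> moves in direction \<open>v\<close>, while the smooth
  tangent spaces \<open>{c s, X (u + s v)}\<^sup>\<bottom>\<close> of \<open>V\<close> have zero derivative there; hence \<open>dX u v\<close> is a multiple
  of \<open>X u\<close> and \<open>v = 0\<close>.  Consequently generic points of every \<open>P u\<close> are nonfocal; there all of
  \<open>X u\<^sup>\<bottom>\<close> consists of velocities of curves in the image, and by continuity the tangent hyperplane at every
  regular point of \<open>P u\<close> is \<open>X u\<^sup>\<bottom>\<close>.  So the Gauss map is \<open>u \<mapsto> [X u]\<close>, of rank equal to the number of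
  parameters.  The implicit function theorem provides regular points on the planes of a small family.
\<close>

section \<open>Linear maps depending on a parameter\<close>

lemma linear_basis_expansion:
  fixes f :: "'a::euclidean_space \<Rightarrow> 'd::real_vector"
  assumes "linear f"
  shows "f x = (\<Sum>b\<in>Basis. (x \<bullet> b) *\<^sub>R f b)"
proof -
  have "f x = f (\<Sum>b\<in>Basis. (x \<bullet> b) *\<^sub>R b)" by (simp add: euclidean_representation)
  also have "\<dots> = (\<Sum>b\<in>Basis. (x \<bullet> b) *\<^sub>R f b)"
    by (simp add: linear_sum[OF assms] linear_scale[OF assms])
  finally show ?thesis .
qed

text \<open>The orthogonal complement of the kernel is mapped bijectively onto the range.\<close>

lemma dim_kernel_plus_dim_range:
  fixes M :: "'a::euclidean_space \<Rightarrow> 'd::euclidean_space"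
  assumes "linear M"
  shows "dim {x. M x = 0} + dim (range M) = DIM('a)"
proof -
  let ?K = "{x. M x = 0}"
  define C where "C = {y \<in> UNIV. \<forall>x\<in>?K. orthogonal x y}"
  have K: "subspace ?K" using linear_subspace_kernel[OF assms] .
  have dimC: "dim C + dim ?K = DIM('a)"
    using dim_subspace_orthogonal_to_vectors[OF K subspace_UNIV] by (simp add: C_def)
  have C: "subspace C"
    unfolding C_def by (auto simp: subspace_def orthogonal_def inner_add_right)
  have "inj_on M C"
  proof (rule inj_onI)
    fix x y assume xy: "x \<in> C" "y \<in> C" "M x = M y"
    then have "x - y \<in> C" "x - y \<in> ?K" using subspace_diff[OF C] by (auto simp: linear_diff[OF assms])
    then have "orthogonal (x - y) (x - y)" unfolding C_def by blast
    then show "x = y" by (simp add: orthogonal_def)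
  qed
  moreover have "range M = M ` C"
  proof -
    have "M x \<in> M ` C" for x
    proof -
      obtain y z where yz: "y \<in> span ?K" "\<And>w. w \<in> span ?K \<Longrightarrow> orthogonal z w" "x = y + z"
        using orthogonal_subspace_decomp_exists[of ?K x] by metis
      then have "z \<in> C" by (auto simp: C_def orthogonal_commute span_base)
      moreover have "M x = M z" using yz K by (simp add: linear_add[OF assms] span_eq_iff[THEN iffD2])
      ultimately show ?thesis by blast
    qed
    then show ?thesis by auto
  qed
  ultimately have "dim (range M) = dim C"
    using dim_image_eq[OF assms, of C] C by (simp add: span_eq_iff[THEN iffD2])
  then show ?thesis using dimC by simp
qed

text \<open>Translates the codimension condition in \<open>tangent_space_at\<close> into
  surjectivity, the form that is stable under perturbation.\<close>

lemma dim_kernel_surj: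
  fixes M :: "'a::euclidean_space \<Rightarrow> 'd::euclidean_space"
  assumes "linear M"
  shows "dim {x. M x = 0} + DIM('d) = DIM('a) \<longleftrightarrow> surj M"
proof -
  have "dim (range M) = DIM('d) \<longleftrightarrow> surj M"
    using assms by (metis dim_UNIV dim_eq_full linear_subspace_image span_eq_iff subspace_UNIV)
  then show ?thesis using dim_kernel_plus_dim_range[OF assms] by linarith
qed

text \<open>Pointwise convergence suffices in finite dimension: once the deviations on the basis
  vectors sum to less than half the lower bound \<open>c\<close> of \<open>M0\<close>, the map
  \<open>M t\<close> still has the lower bound \<open>c / 2\<close>, uniformly in
  \<open>x\<close>.\<close>

lemma inj_perturbation:
  fixes M :: "'t \<Rightarrow> 'a::euclidean_space \<Rightarrow> 'd::euclidean_space"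
  assumes lin: "\<forall>\<^sub>F t in F. linear (M t)" "linear M0" and "inj M0"
    and lim: "\<And>z. ((\<lambda>t. M t z) \<longlongrightarrow> M0 z) F"
  shows "\<exists>C>0. \<forall>\<^sub>F t in F. \<forall>x. norm x \<le> C * norm (M t x)"
proof -
  obtain c where c: "c > 0" "\<And>x. c * norm x \<le> norm (M0 x)"
    using linear_inj_bounded_below_pos[OF lin(2) \<open>inj M0\<close>] by (metis mult.commute)
  have "((\<lambda>t. \<Sum>b\<in>Basis. norm (M t b - M0 b)) \<longlongrightarrow> (\<Sum>b\<in>(Basis::'a set). 0)) F"
    by (intro tendsto_sum) (use lim in \<open>simp add: LIM_zero tendsto_norm_zero\<close>)
  then have "\<forall>\<^sub>F t in F. (\<Sum>b\<in>Basis. norm (M t b - M0 b)) < c / 2"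
    using c(1) by (intro order_tendstoD(2)) auto
  with lin(1) have "\<forall>\<^sub>F t in F. \<forall>x. norm x \<le> (2 / c) * norm (M t x)"
  proof (eventually_elim, intro allI)
    fix t x assume lint: "linear (M t)" and le: "(\<Sum>b\<in>Basis. norm (M t b - M0 b)) < c / 2"
    have "M t x - M0 x = (\<Sum>b\<in>Basis. (x \<bullet> b) *\<^sub>R (M t b - M0 b))"
      using linear_basis_expansion[OF linear_compose_sub[OF lint lin(2)]] .
    also have "norm \<dots> \<le> (\<Sum>b\<in>Basis. norm x * norm (M t b - M0 b))"
      by (rule sum_norm_le) (simp add: Basis_le_norm mult_right_mono)
    also have "\<dots> = norm x * (\<Sum>b\<in>Basis. norm (M t b - M0 b))"
      by (simp add: sum_distrib_left)
    also have "\<dots> \<le> norm x * (c / 2)"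
      using le by (intro mult_left_mono) auto
    finally have "norm (M0 x) - norm (M t x) \<le> norm x * (c / 2)"
      by (smt (verit) norm_minus_commute norm_triangle_ineq2)
    with c(2)[of x] have "norm x * (c / 2) \<le> norm (M t x)" by (simp add: algebra_simps)
    then show "norm x \<le> (2 / c) * norm (M t x)" using c(1) by (simp add: field_simps)
  qed
  then show ?thesis using c(1) by (intro exI[of _ "2 / c"]) auto
qed

text \<open>Composing with a right inverse \<open>R\<close> of \<open>M0\<close> reduces this to
  endomorphisms near the identity. The linear bound on the preimage \<open>d\<close> later makes
  corrections as small as the defects they remove.\<close>

lemma surj_perturbation:
  fixes M :: "'t \<Rightarrow> 'a::euclidean_space \<Rightarrow> 'd::euclidean_space"
  assumes lin: "\<forall>\<^sub>F t in F. linear (M t)" "linear M0" and "surj M0"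
    and lim: "\<And>z. ((\<lambda>t. M t z) \<longlongrightarrow> M0 z) F"
  shows "\<exists>C>0. \<forall>\<^sub>F t in F. \<forall>y. \<exists>d. M t d = y \<and> norm d \<le> C * norm y"
proof -
  obtain R where R: "linear R" "M0 \<circ> R = id"
    using linear_surjective_right_inverse[OF lin(2) \<open>surj M0\<close>] by blast
  have lin': "\<forall>\<^sub>F t in F. linear (M t \<circ> R)"
    using lin(1) by eventually_elim (rule linear_compose[OF R(1)])
  have "\<exists>C>0. \<forall>\<^sub>F t in F. \<forall>x. norm x \<le> C * norm ((M t \<circ> R) x)"
  proof (rule inj_perturbation[where ?M0.0 = "M0 \<circ> R"])
    show "linear (M0 \<circ> R)" "inj (M0 \<circ> R)" using R(2) by (simp_all add: linear_id)
    show "((\<lambda>t. (M t \<circ> R) z) \<longlongrightarrow> (M0 \<circ> R) z) F" for z using lim[of "R z"] by simp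
  qed (rule lin')
  then obtain C where C: "C > 0" "\<forall>\<^sub>F t in F. \<forall>x. norm x \<le> C * norm ((M t \<circ> R) x)" by blast
  obtain K where K: "K > 0" "\<And>x. norm (R x) \<le> K * norm x"
    using linear_bounded_pos[OF R(1)] by blast
  from lin' C(2) have "\<forall>\<^sub>F t in F. \<forall>y. \<exists>d. M t d = y \<and> norm d \<le> (K * C) * norm y"
  proof (eventually_elim, intro allI)
    fix t y assume lint: "linear (M t \<circ> R)" and le: "\<forall>x. norm x \<le> C * norm ((M t \<circ> R) x)"
    have "inj (M t \<circ> R)"
      using le by (subst linear_injective_0[OF lint]) (metis mult_zero_right norm_le_zero_iff norm_zero)
    then have "surj (M t \<circ> R)" using linear_injective_imp_surjective[OF lint] by blast
    then obtain x where x: "(M t \<circ> R) x = y" by (metis surjD)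
    have "norm (R x) \<le> K * norm x" by (rule K)
    also have "\<dots> \<le> K * (C * norm y)" using le x K(1) by (intro mult_left_mono) auto
    finally show "\<exists>d. M t d = y \<and> norm d \<le> (K * C) * norm y" using x by (auto intro!: exI[of _ "R x"])
  qed
  then show ?thesis using C(1) K(1) by (intro exI[of _ "K * C"]) auto
qed

text \<open>Eigenvectors of distinct eigenvalues are independent, so there are at most
  \<open>DIM('a)\<close> eigenvalues. This bounds the singular members of a linear pencil of second
  fundamental forms.\<close>

lemma finite_eigenvalues:
  fixes A :: "'a::euclidean_space \<Rightarrow> 'a"
  assumes "linear A"
  shows "finite {t::real. \<exists>x. x \<noteq> 0 \<and> A x = t *\<^sub>R x}"
proof (rule ccontr)
  let ?E = "{t::real. \<exists>x. x \<noteq> 0 \<and> A x = t *\<^sub>R x}"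
  assume "infinite ?E"
  then obtain S where S: "finite S" "card S = DIM('a) + 1" "S \<subseteq> ?E"
    using infinite_arbitrarily_large by blast
  have "\<forall>t\<in>S. \<exists>x. x \<noteq> 0 \<and> A x = t *\<^sub>R x" using S(3) by auto
  from bchoice[OF this] obtain e where e: "\<forall>t\<in>S. e t \<noteq> 0 \<and> A (e t) = t *\<^sub>R e t" ..
  have "inj_on e T \<and> independent (e ` T)" if "finite T" "T \<subseteq> S" for T
    using that
  proof (induction T)
    case (insert t T)
    then have IH: "inj_on e T" "independent (e ` T)" and ts: "t \<in> S" "T \<subseteq> S" by auto
    have nin: "e t \<notin> span (e ` T)"
    proof
      assume "e t \<in> span (e ` T)"
      then obtain c where c: "e t = (\<Sum>v\<in>e ` T. c v *\<^sub>R v)"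
        using span_finite[of "e ` T"] insert.hyps by auto
      then have c': "e t = (\<Sum>s\<in>T. c (e s) *\<^sub>R e s)" using IH(1) by (simp add: sum.reindex)
      \<comment> \<open>Applying \<open>t - A\<close> to the expansion of \<open>e t\<close> kills
        the left side and multiplies the coefficient at \<open>e s\<close> by \<open>t - s\<close>,
        which is nonzero because \<open>t\<close> is not in \<open>T\<close>.\<close>
      have "(\<Sum>s\<in>T. (c (e s) * (t - s)) *\<^sub>R e s) = t *\<^sub>R e t - A (e t)"
      proof -
        have "A (e t) = (\<Sum>s\<in>T. (c (e s) * s) *\<^sub>R e s)"
          using ts(2) e by (subst c') (auto simp: linear_sum[OF assms] linear_scale[OF assms] intro!: sum.cong)
        moreover have "t *\<^sub>R e t = (\<Sum>s\<in>T. (c (e s) * t) *\<^sub>R e s)"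
          by (subst c') (simp add: scaleR_sum_right mult.commute)
        ultimately show ?thesis by (simp add: sum_subtractf[symmetric] algebra_simps)
      qed
      also have "\<dots> = 0" using e ts by simp
      finally have "(\<Sum>v\<in>e ` T. (c v * (t - inv_into T e v)) *\<^sub>R v) = 0"
        using IH(1) by (simp add: sum.reindex)
      then have "\<forall>v\<in>e ` T. c v * (t - inv_into T e v) = 0"
        by (intro ballI independentD[OF IH(2) finite_imageI[OF insert.hyps(1)] subset_refl])
      then have "\<forall>s\<in>T. c (e s) * (t - s) = 0" using IH(1) by simp
      then have "\<forall>s\<in>T. c (e s) = 0" using insert.hyps by auto
      then have "e t = 0" using c' by simp
      then show False using e ts by blast
    qed
    then have "e t \<notin> e ` T" using span_base[of "e t" "e ` T"] by blast
    then show ?case using IH nin by (auto simp: independent_insertI)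
  qed (auto simp: independent_empty)
  then have "inj_on e S" "independent (e ` S)" using S by auto
  then have "card S \<le> DIM('a)" using independent_bound[of "e ` S"] by (simp add: card_image)
  then show False using S by simp
qed

section \<open>Calculus of continuously differentiable functions\<close>

lemma Ck_on_cong:
  assumes "open S" "\<And>x. x \<in> S \<Longrightarrow> f x = g x"
  shows "Ck_on k S f \<longleftrightarrow> Ck_on k S g"
  using assms(2)
proof (induction k arbitrary: f g)
  case 0
  then show ?case by (simp cong: continuous_on_cong)
next
  case (Suc k)
  have D: "(f has_derivative D) (at x) \<longleftrightarrow> (g has_derivative D) (at x)" if "x \<in> S" for x D
    using has_derivative_transform_within_open[OF _ \<open>open S\<close> that, of f D UNIV g]
      has_derivative_transform_within_open[OF _ \<open>open S\<close> that, of g D UNIV f] Suc.prems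
    by auto
  then have "f differentiable at x \<longleftrightarrow> g differentiable at x"
    and "frechet_derivative f (at x) = frechet_derivative g (at x)" if "x \<in> S" for x
    using that by (simp_all add: differentiable_def frechet_derivative_def)
  moreover from this have "Ck_on k S (\<lambda>x. frechet_derivative f (at x) v) \<longleftrightarrow>
      Ck_on k S (\<lambda>x. frechet_derivative g (at x) v)" for v
    by (intro Suc.IH) simp
  ultimately show ?case by simp
qed

lemma Ck_on_subset: "Ck_on k S f \<Longrightarrow> T \<subseteq> S \<Longrightarrow> Ck_on k T f"
  by (induction k arbitrary: f) (auto intro: continuous_on_subset)

lemma Ck_on_SucD: "Ck_on (Suc k) S f \<Longrightarrow> Ck_on k S f"
proof (induction k arbitrary: f)
  case 0
  then have "f differentiable at x within S" if "x \<in> S" for x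
    using that by (simp add: differentiable_at_withinI)
  then show ?case by (simp add: differentiable_imp_continuous_on differentiable_on_def)
next
  case (Suc k)
  then show ?case by (metis Ck_on.simps(2))
qed

lemma Ck_on_SucI:
  assumes "open S" "\<And>x. x \<in> S \<Longrightarrow> (f has_derivative f' x) (at x)"
    and "\<And>v. Ck_on k S (\<lambda>x. f' x v)"
  shows "Ck_on (Suc k) S f"
proof -
  have "frechet_derivative f (at x) = f' x" if "x \<in> S" for x
    using frechet_derivative_at[OF assms(2)[OF that]] by simp
  then have "Ck_on k S (\<lambda>x. frechet_derivative f (at x) v)" for v
    using Ck_on_cong[OF assms(1), of "\<lambda>x. frechet_derivative f (at x) v" "\<lambda>x. f' x v" k] assms(3)
    by simp
  then show ?thesis using assms(2) by (auto simp: differentiable_def)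
qed

lemma Ck_on_Suc_derivative:
  assumes "Ck_on (Suc k) S f" "x \<in> S"
  shows "(f has_derivative frechet_derivative f (at x)) (at x)"
  using assms frechet_derivative_works by auto

lemma Ck_on_const: "open S \<Longrightarrow> Ck_on k S (\<lambda>x. c)"
proof (induction k arbitrary: c)
  case (Suc k)
  then show ?case using Ck_on_SucI[OF \<open>open S\<close>, where f'="\<lambda>x v. 0"] by simp
qed simp

lemma Ck_on_bounded_linear_compose:
  assumes "bounded_linear L" "open S" "Ck_on k S f"
  shows "Ck_on k S (\<lambda>x. L (f x))"
  using assms(3)
proof (induction k arbitrary: f)
  case 0
  then show ?case using bounded_linear.continuous_on[OF assms(1)] by simp
next
  case (Suc k)
  show ?case
    by (rule Ck_on_SucI[OF assms(2) bounded_linear.has_derivative[OF assms(1)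
            Ck_on_Suc_derivative[OF Suc.prems]]])
      (use Suc in auto)
qed

lemma Ck_on_ident: "open S \<Longrightarrow> Ck_on k S (\<lambda>x. x)"
proof (cases k)
  case (Suc j)
  assume "open S"
  then show ?thesis using Suc Ck_on_SucI[OF \<open>open S\<close> has_derivative_ident] Ck_on_const by blast
qed simp

lemma Ck_on_add:
  assumes "open S" "Ck_on k S a" "Ck_on k S b"
  shows "Ck_on k S (\<lambda>x. a x + b x)"
  using assms(2,3)
proof (induction k arbitrary: a b)
  case 0
  then show ?case by (simp add: continuous_on_add)
next
  case (Suc k)
  show ?case
    by (rule Ck_on_SucI[OF assms(1) has_derivative_add[OF Ck_on_Suc_derivative[OF Suc.prems(1)]
            Ck_on_Suc_derivative[OF Suc.prems(2)]]])
      (use Suc in auto)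
qed

lemma Ck_on_bounded_bilinear:
  assumes "bounded_bilinear P" "open S" "Ck_on k S f" "Ck_on k S g"
  shows "Ck_on k S (\<lambda>x. P (f x) (g x))"
  using assms(3,4)
proof (induction k arbitrary: f g)
  case 0
  then show ?case using bounded_bilinear.continuous_on[OF assms(1)] by simp
next
  case (Suc k)
  let ?f' = "\<lambda>x. frechet_derivative f (at x)" and ?g' = "\<lambda>x. frechet_derivative g (at x)"
  have IH: "Ck_on k S (\<lambda>x. P (f x) (?g' x v))" "Ck_on k S (\<lambda>x. P (?f' x v) (g x))" for v
    using Suc.IH Suc.prems Ck_on_SucD[OF Suc.prems(1)] Ck_on_SucD[OF Suc.prems(2)] by auto
  have "Ck_on k S (\<lambda>x. P (f x) (?g' x v) + P (?f' x v) (g x))" for v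
    by (intro Ck_on_add assms(2) IH)
  then show ?case
    by (intro Ck_on_SucI[OF assms(2) bounded_bilinear.FDERIV[OF assms(1)
            Ck_on_Suc_derivative[OF Suc.prems(1)] Ck_on_Suc_derivative[OF Suc.prems(2)]]])
qed

lemma Ck_on_diff:
  assumes "open S" "Ck_on k S a" "Ck_on k S b"
  shows "Ck_on k S (\<lambda>x. a x - b x)"
  using Ck_on_add[OF assms(1,2) Ck_on_bounded_linear_compose[OF bounded_linear_minus[OF bounded_linear_ident]
    assms(1,3)]] by simp

lemma Ck_on_sum:
  assumes "open S" "\<And>i. i \<in> I \<Longrightarrow> Ck_on k S (f i)"
  shows "Ck_on k S (\<lambda>x. \<Sum>i\<in>I. f i x)"
  using assms(2) by (induction I rule: infinite_finite_induct)
    (auto intro: Ck_on_const Ck_on_add assms(1))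

text \<open>Expanding the argument in the basis reduces the claim to the columns of the matrix and
  the coordinates of the vector.\<close>

lemma Ck_on_linear_apply:
  fixes A :: "'z::real_normed_vector \<Rightarrow> 'a::euclidean_space \<Rightarrow> 'd::real_normed_vector"
  assumes "open S" "\<And>z. z \<in> S \<Longrightarrow> linear (A z)" "\<And>b. b \<in> Basis \<Longrightarrow> Ck_on k S (\<lambda>z. A z b)" "Ck_on k S y"
  shows "Ck_on k S (\<lambda>z. A z (y z))"
proof -
  have "Ck_on k S (\<lambda>z. \<Sum>b\<in>Basis. (y z \<bullet> b) *\<^sub>R A z b)"
    by (intro Ck_on_sum Ck_on_bounded_bilinear[OF bounded_bilinear_scaleR]
        Ck_on_bounded_linear_compose[OF bounded_linear_inner_left] assms) auto
  then show ?thesis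
    using Ck_on_cong[OF assms(1), of "\<lambda>z. A z (y z)" "\<lambda>z. \<Sum>b\<in>Basis. (y z \<bullet> b) *\<^sub>R A z b"]
      linear_basis_expansion[OF assms(2)] by blast
qed

text \<open>By the chain rule the derivative is a point-dependent linear map applied to a vector;
  its columns are again composites with \<open>\<phi>\<close>, so the induction runs over all outer
  functions \<open>f\<close>.\<close>

lemma Ck_on_compose:
  fixes \<phi> :: "'z::real_normed_vector \<Rightarrow> 'a::euclidean_space"
  assumes "open S" "Ck_on k T f" "Ck_on k S \<phi>" "\<phi> ` S \<subseteq> T"
  shows "Ck_on k S (\<lambda>z. f (\<phi> z))"
  using assms(2,3)
proof (induction k arbitrary: f)
  case 0
  then show ?case using continuous_on_compose2[OF _ _ assms(4)] by simp
next
  case (Suc k)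
  have D: "(f has_derivative frechet_derivative f (at (\<phi> z))) (at (\<phi> z))" if "z \<in> S" for z
    using Ck_on_Suc_derivative[OF Suc.prems(1)] assms(4) that by auto
  have D': "((\<lambda>z. f (\<phi> z)) has_derivative
      (\<lambda>v. frechet_derivative f (at (\<phi> z)) (frechet_derivative \<phi> (at z) v))) (at z)" if "z \<in> S" for z
    using has_derivative_compose[OF Ck_on_Suc_derivative[OF Suc.prems(2) that] D[OF that]] .
  show ?case
  proof (rule Ck_on_SucI[OF assms(1) D'])
    fix v
    show "Ck_on k S (\<lambda>z. frechet_derivative f (at (\<phi> z)) (frechet_derivative \<phi> (at z) v))"
    proof (rule Ck_on_linear_apply[OF assms(1)])
      show "linear (frechet_derivative f (at (\<phi> z)))" if "z \<in> S" for z
        using has_derivative_linear[OF D[OF that]] .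
      show "Ck_on k S (\<lambda>z. frechet_derivative f (at (\<phi> z)) b)" for b
        using Suc.prems(1) by (intro Suc.IH Ck_on_SucD[OF Suc.prems(2)]) simp
      show "Ck_on k S (\<lambda>z. frechet_derivative \<phi> (at z) v)" using Suc.prems(2) by simp
    qed
  qed
qed

text \<open>Implicit differentiation gives \<open>A (dy v) = db v - (dA v) y\<close>, again a system with matrix \<open>A\<close>;
  so smoothness propagates without an explicit formula for the inverse of \<open>A\<close>.\<close>

lemma Ck_on_linear_solve:
  fixes A :: "'z::real_normed_vector \<Rightarrow> 'a::euclidean_space \<Rightarrow> 'a"
  assumes "open S" "\<And>z. z \<in> S \<Longrightarrow> linear (A z)" "\<And>z. z \<in> S \<Longrightarrow> inj (A z)"
    and "\<And>x. Ck_on k S (\<lambda>z. A z x)" "Ck_on k S b"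
    and "\<And>z. z \<in> S \<Longrightarrow> A z (y z) = b z"
  shows "Ck_on k S y"
  using assms(4-)
proof (induction k arbitrary: b y)
  case 0
  have "(y \<longlongrightarrow> y z0) (at z0)" if z0: "z0 \<in> S" for z0
  proof -
    have ev: "\<forall>\<^sub>F z in at z0. z \<in> S" using assms(1) z0 by (rule eventually_at_in_open')
    have lim: "((\<lambda>z. A z x) \<longlongrightarrow> A z0 x) (at z0)" for x
      using 0(1)[of x] z0 assms(1) by (simp add: continuous_on_eq_continuous_at isCont_def)
    have "\<exists>C>0. \<forall>\<^sub>F z in at z0. \<forall>x. norm x \<le> C * norm (A z x)"
      using ev by (intro inj_perturbation[where ?M0.0 = "A z0"] lim assms z0)
        (auto elim!: eventually_mono intro: assms)
    then obtain C where C: "\<forall>\<^sub>F z in at z0. \<forall>x. norm x \<le> C * norm (A z x)" by blast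
    have "((\<lambda>z. b z - A z (y z0)) \<longlongrightarrow> b z0 - A z0 (y z0)) (at z0)"
      using 0(2) z0 assms(1)
      by (intro tendsto_diff lim) (simp add: continuous_on_eq_continuous_at isCont_def)
    then have "((\<lambda>z. b z - A z (y z0)) \<longlongrightarrow> 0) (at z0)" using 0(3) z0 by simp
    then have "((\<lambda>z. C * norm (b z - A z (y z0))) \<longlongrightarrow> 0) (at z0)"
      by (metis mult_zero_right norm_zero tendsto_mult_left tendsto_norm)
    \<comment> \<open>The difference \<open>y z - y z0\<close> solves the system with right-hand
      side \<open>b z - A z (y z0)\<close>, which tends to 0; the uniform lower bound on
      \<open>A z\<close> transfers this to the difference.\<close>
    moreover have "\<forall>\<^sub>F z in at z0. norm (y z - y z0) \<le> C * norm (b z - A z (y z0))"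
      using C ev
    proof eventually_elim
      case (elim z)
      then have "A z (y z - y z0) = b z - A z (y z0)"
        by (simp add: linear_diff[OF assms(2)] 0(3))
      with elim(1) show ?case by metis
    qed
    ultimately have "((\<lambda>z. y z - y z0) \<longlongrightarrow> 0) (at z0)" by (rule Lim_null_comparison[rotated])
    then show ?thesis by (simp add: LIM_zero_iff)
  qed
  then show ?case using assms(1) by (simp add: continuous_on_eq_continuous_at isCont_def)
next
  case (Suc k)
  \<comment> \<open>The derivative of \<open>z \<mapsto> A z x\<close> in direction
    \<open>v\<close>, assembled from the columns so that it is visibly linear in
    \<open>x\<close>.\<close>
  define A' where "A' z x v = (\<Sum>e\<in>Basis. (x \<bullet> e) *\<^sub>R frechet_derivative (\<lambda>z. A z e) (at z) v)"
    for z x v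
  have A'1: "((\<lambda>z. A z x) has_derivative A' z x) (at z)" if "z \<in> S" for z x
  proof -
    have "((\<lambda>z. \<Sum>e\<in>Basis. (x \<bullet> e) *\<^sub>R A z e) has_derivative A' z x) (at z)"
      unfolding A'_def by (intro has_derivative_sum has_derivative_scaleR_right
          Ck_on_Suc_derivative[OF Suc.prems(1) that])
    then show ?thesis
      by (rule has_derivative_transform_within_open[OF _ assms(1) that])
        (simp add: linear_basis_expansion[OF assms(2), symmetric])
  qed
  have A'2: "linear (\<lambda>x. A' z x v)" for z v
    unfolding A'_def by (intro linearI)
      (simp_all add: inner_add_left scaleR_add_left sum.distrib scaleR_sum_right)
  have A'3: "Ck_on k S (\<lambda>z. A' z x v)" for x v
    unfolding A'_def using Suc.prems(1)
    by (intro Ck_on_sum Ck_on_bounded_linear_compose[OF bounded_linear_scaleR_right] assms) auto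
  let ?b' = "\<lambda>z. frechet_derivative b (at z)"
  have "\<exists>L. linear L \<and> A z \<circ> L = id" if "z \<in> S" for z
    using linear_surjective_right_inverse linear_injective_imp_surjective assms(2,3) that by metis
  then obtain L where L: "\<And>z. z \<in> S \<Longrightarrow> linear (L z) \<and> A z \<circ> L z = id" by metis
  \<comment> \<open>The candidate derivative of \<open>y\<close>: the solution of the differentiated
    system, found with a right inverse of \<open>A z\<close>.\<close>
  define y' where "y' z v = L z (?b' z v - A' z (y z) v)" for z v
  have Ay': "A z (y' z v) = ?b' z v - A' z (y z) v" if "z \<in> S" for z v
    using L[OF that] unfolding y'_def by (metis comp_eq_dest_lhs id_apply)
  have der: "(y has_derivative y' z0) (at z0)" if z0: "z0 \<in> S" for z0
  proof -
    have ev: "\<forall>\<^sub>F z in at z0. z \<in> S" using assms(1) z0 by (rule eventually_at_in_open')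
    have lim: "((\<lambda>z. A z x) \<longlongrightarrow> A z0 x) (at z0)" for x
      using has_derivative_continuous[OF A'1[OF z0]] by (simp add: isCont_def)
    have "\<exists>C>0. \<forall>\<^sub>F z in at z0. \<forall>x. norm x \<le> C * norm (A z x)"
      using ev by (intro inj_perturbation[where ?M0.0 = "A z0"] lim assms z0)
        (auto elim!: eventually_mono intro: assms)
    then obtain C where C: "C > 0" "\<forall>\<^sub>F z in at z0. \<forall>x. norm x \<le> C * norm (A z x)" by blast
    \<comment> \<open>Freezing \<open>y z0\<close> makes \<open>G\<close> differentiable before
      anything is known about \<open>y\<close>. On \<open>S\<close> it equals
      \<open>A z (y z - y z0)\<close>, so it carries the increment of \<open>y\<close>.\<close>
    define G where "G z = b z - A z (y z0)" for z
    have G: "(G has_derivative (\<lambda>v. A z0 (y' z0 v))) (at z0)"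
      unfolding G_def Ay'[OF z0]
      by (intro has_derivative_diff A'1 z0 Ck_on_Suc_derivative[OF Suc.prems(2)])
    have G0: "G z0 = 0" using Suc.prems(3)[OF z0] by (simp add: G_def)
    have "bounded_linear (\<lambda>v. ?b' z0 v - A' z0 (y z0) v)"
      by (intro bounded_linear_sub has_derivative_bounded_linear[OF A'1[OF z0]]
          has_derivative_bounded_linear[OF Ck_on_Suc_derivative[OF Suc.prems(2) z0]])
    moreover have "bounded_linear (L z0)" using L[OF z0] linear_conv_bounded_linear by blast
    ultimately have bl: "bounded_linear (y' z0)"
      unfolding y'_def by (rule bounded_linear_compose[rotated])
    obtain K where K: "K > 0" "\<And>v. norm (y' z0 v) \<le> norm v * K"
      using bounded_linear.pos_bounded[OF bl] by blast
    define \<epsilon> where "\<epsilon> z = (\<Sum>e\<in>Basis. norm (A z e - A z0 e))" for z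
    have "(\<epsilon> \<longlongrightarrow> (\<Sum>e\<in>(Basis::'a set). 0)) (at z0)"
      unfolding \<epsilon>_def by (intro tendsto_sum) (use lim in \<open>simp add: LIM_zero tendsto_norm_zero\<close>)
    then have \<epsilon>: "(\<epsilon> \<longlongrightarrow> 0) (at z0)" by simp
    have Glim: "((\<lambda>z. norm (G z - G z0 - A z0 (y' z0 (z - z0))) / norm (z - z0)) \<longlongrightarrow> 0) (at z0)"
      using G by (simp add: has_derivative_iff_norm)
    have "((\<lambda>z. C * (norm (G z - G z0 - A z0 (y' z0 (z - z0))) / norm (z - z0) + K * \<epsilon> z))
        \<longlongrightarrow> C * (0 + K * 0)) (at z0)"
      by (intro tendsto_mult tendsto_add tendsto_const Glim \<epsilon>)
    then have lim0: "((\<lambda>z. C * (norm (G z - G z0 - A z0 (y' z0 (z - z0))) / norm (z - z0) + K * \<epsilon> z))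
        \<longlongrightarrow> 0) (at z0)" by simp
    have "\<forall>\<^sub>F z in at z0. norm (norm (y z - y z0 - y' z0 (z - z0)) / norm (z - z0)) \<le>
        C * (norm (G z - G z0 - A z0 (y' z0 (z - z0))) / norm (z - z0) + K * \<epsilon> z)"
      using C(2) ev eventually_neq_at_within[of z0 z0 UNIV]
    proof eventually_elim
      case (elim z)
      let ?h = "y' z0 (z - z0)"
      have lin: "linear (A z)" using assms(2) elim by blast
      \<comment> \<open>The image of the remainder of \<open>y\<close> under \<open>A z\<close>
        splits into the remainder of \<open>G\<close> and the change of \<open>A\<close> on the
        increment \<open>?h\<close>, which is at most
        \<open>norm (z - z0) * K * \<epsilon> z\<close>.\<close>
      have "A z (y z - y z0 - ?h) = (G z - G z0 - A z0 ?h) - (A z ?h - A z0 ?h)"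
        using Suc.prems(3)[OF elim(2)] G0 by (simp add: linear_diff[OF lin] G_def)
      moreover have "norm (A z ?h - A z0 ?h) \<le> norm (z - z0) * K * \<epsilon> z"
      proof -
        have "A z ?h - A z0 ?h = (\<Sum>e\<in>Basis. (?h \<bullet> e) *\<^sub>R (A z e - A z0 e))"
          using linear_basis_expansion[OF linear_compose_sub[OF lin assms(2)[OF z0]]] .
        also have "norm \<dots> \<le> (\<Sum>e\<in>Basis. norm ?h * norm (A z e - A z0 e))"
          by (rule sum_norm_le) (simp add: Basis_le_norm mult_right_mono)
        also have "\<dots> = norm ?h * \<epsilon> z" by (simp add: sum_distrib_left \<epsilon>_def)
        also have "\<dots> \<le> norm (z - z0) * K * \<epsilon> z"
          by (intro mult_right_mono K) (simp add: \<epsilon>_def sum_nonneg)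
        finally show ?thesis .
      qed
      ultimately have "norm (A z (y z - y z0 - ?h)) \<le>
          norm (G z - G z0 - A z0 ?h) + norm (z - z0) * K * \<epsilon> z"
        by (smt (verit) norm_triangle_ineq4)
      then have "norm (y z - y z0 - ?h) \<le>
          C * (norm (G z - G z0 - A z0 ?h) + norm (z - z0) * K * \<epsilon> z)"
        using elim(1) C(1) by (smt (verit) mult_left_mono)
      then show ?case using elim(3) by (simp add: field_simps)
    qed
    from Lim_null_comparison[OF this lim0] show ?thesis
      unfolding has_derivative_iff_norm using bl by blast
  qed
  have y: "Ck_on k S y"
    using Suc.IH[of b y] Suc.prems Ck_on_SucD by blast
  show ?case
  proof (rule Ck_on_SucI[OF assms(1) der])
    fix v
    show "Ck_on k S (\<lambda>z. y' z v)"
    proof (rule Suc.IH[where b="\<lambda>z. ?b' z v - A' z (y z) v"])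
      show "Ck_on k S (\<lambda>z. A z x)" for x using Ck_on_SucD[OF Suc.prems(1)] .
      show "Ck_on k S (\<lambda>z. ?b' z v - A' z (y z) v)"
        by (rule Ck_on_diff[OF assms(1) _ Ck_on_linear_apply[OF assms(1) A'2 A'3 y]])
          (use Suc.prems(2) in simp)
    qed (rule Ay')
  qed
qed

section \<open>Families of characteristic planes\<close>

text \<open>A correction dominated by a defect with zero derivative leaves velocities unchanged. The
  correction may come from an arbitrary choice, so only the bound is known about it; the bound at
  \<open>t\<close> itself gives \<open>d t = 0\<close>.\<close>

lemma has_derivative_zero_dominated:
  assumes "(y has_derivative (\<lambda>_. 0)) (at t)" "y t = 0"
    and le: "\<forall>\<^sub>F s in nhds t. norm (d s) \<le> C * norm (y s)"
  shows "(d has_derivative (\<lambda>_. 0)) (at t)"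
proof -
  have dt: "d t = 0" using eventually_nhds_x_imp_x[OF le] assms(2) by simp
  have "((\<lambda>s. norm (y s) / norm (s - t)) \<longlongrightarrow> 0) (at t)"
    using assms(1,2) by (simp add: has_derivative_iff_norm)
  then have lim: "((\<lambda>s. C * (norm (y s) / norm (s - t))) \<longlongrightarrow> 0) (at t)"
    using tendsto_mult_right_zero by blast
  have "\<forall>\<^sub>F s in at t. norm (norm (d s - d t - 0) / norm (s - t)) \<le> C * (norm (y s) / norm (s - t))"
    using filter_leD[OF at_within_le_nhds le]
    by eventually_elim (simp add: dt divide_right_mono)
  from Lim_null_comparison[OF this lim] show ?thesis
    unfolding has_derivative_iff_norm by simp
qed

text \<open>Signature and positivity are weakened here to nondegeneracy of \<open>B\<close> and
  \<open>X u\<close> being nonzero; positivity of \<open>B (X u) (X u)\<close> returns as an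
  explicit hypothesis of \<open>regular_characteristic_nonfocal\<close>.\<close>

locale plane_family =
  fixes B :: "'a::euclidean_space \<Rightarrow> 'a \<Rightarrow> real"
    and D :: "'b::euclidean_space set" and X :: "'b \<Rightarrow> 'a"
  assumes bilinear: "bilinear B" and sym: "B x y = B y x"
    and nondegenerate: "(\<And>y. B x y = 0) \<Longrightarrow> x = 0"
    and open_D: "open D" and smooth: "smooth_on D X"
    and X_nonzero: "u \<in> D \<Longrightarrow> X u \<noteq> 0"
    and immersion: "u \<in> D \<Longrightarrow> frechet_derivative X (at u) v = c *\<^sub>R X u \<Longrightarrow> v = 0"
begin

abbreviation dX :: "'b \<Rightarrow> 'b \<Rightarrow> 'a" where
  "dX u \<equiv> frechet_derivative X (at u)"

abbreviation ddX :: "'b \<Rightarrow> 'b \<Rightarrow> 'b \<Rightarrow> 'a" where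
  "ddX u v \<equiv> frechet_derivative (\<lambda>u. dX u v) (at u)"

abbreviation P :: "'b \<Rightarrow> 'a set" where
  "P \<equiv> characteristic_plane B X"

text \<open>The covector \<open>B x\<close>, represented by a vector for the class inner product,
  which is how normals occur in \<open>gauss_map_rank\<close>.\<close>

definition J :: "'a \<Rightarrow> 'a" where
  "J x = (\<Sum>b\<in>Basis. B x b *\<^sub>R b)"

text \<open>For \<open>u\<close> in \<open>D\<close> this is the gradient at \<open>u\<close> of the
  function \<open>u \<mapsto> B z (X u)\<close> with \<open>z\<close> fixed.\<close>

definition grad_pairing :: "'b \<Rightarrow> 'a \<Rightarrow> 'b" where
  "grad_pairing u z = (\<Sum>e\<in>Basis. B z (dX u e) *\<^sub>R e)"

definition plane_map :: "'b \<Rightarrow> 'a \<Rightarrow> real \<times> 'b" where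
  "plane_map u z = (B z (X u), grad_pairing u z)"

text \<open>The second fundamental form of the image at the point \<open>q\<close> of the plane \<open>P u\<close>.
  It is singular exactly at the focal points.\<close>

definition hess :: "'b \<Rightarrow> 'a \<Rightarrow> 'b \<Rightarrow> 'b" where
  "hess u q v = (\<Sum>e\<in>Basis. B q (ddX u e v) *\<^sub>R e)"

lemma bounded_bilinear: "bounded_bilinear B"
  using bilinear bilinear_conv_bounded_bilinear by blast

sublocale B: bounded_bilinear B by (rule bounded_bilinear)

lemma J_inner: "J x \<bullet> y = B x y"
proof -
  have "B x y = (\<Sum>b\<in>Basis. (y \<bullet> b) *\<^sub>R B x b)"
    by (rule linear_basis_expansion[OF bounded_linear.linear[OF B.bounded_linear_right]])
  then show ?thesis by (simp add: J_def inner_sum_left inner_commute[of y] mult.commute)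
qed

lemma J_linear: "linear J"
  unfolding J_def
  by (rule linearI) (simp_all add: B.add_left B.scaleR_left scaleR_add_left sum.distrib scaleR_sum_right)

lemma J_inj: "inj J"
proof -
  have "x = 0" if "J x = 0" for x
    using nondegenerate[of x] J_inner[of x] that by simp
  then show ?thesis using linear_injective_0[OF J_linear] by blast
qed

lemma has_derivative_X: "u \<in> D \<Longrightarrow> (X has_derivative dX u) (at u)"
  and has_derivative_dX: "u \<in> D \<Longrightarrow> ((\<lambda>u. dX u v) has_derivative ddX u v) (at u)"
  and Ck_X: "Ck_on k D X" and Ck_dX: "Ck_on k D (\<lambda>u. dX u v)" and Ck_ddX: "Ck_on k D (\<lambda>u. ddX u v w)"
proof -
  have s: "Ck_on k D X" for k using smooth by (simp add: smooth_on_def)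
  show "u \<in> D \<Longrightarrow> (X has_derivative dX u) (at u)" using Ck_on_Suc_derivative s by blast
  show "u \<in> D \<Longrightarrow> ((\<lambda>u. dX u v) has_derivative ddX u v) (at u)"
    using s[of 2] by (intro Ck_on_Suc_derivative[of 0 D]) (simp_all add: numeral_2_eq_2)
  show "Ck_on k D X" "Ck_on k D (\<lambda>u. dX u v)" "Ck_on k D (\<lambda>u. ddX u v w)"
    using s[of k] s[of "Suc k"] s[of "Suc (Suc k)"] by simp_all
qed

lemma dX_linear: "u \<in> D \<Longrightarrow> linear (dX u)" and ddX_linear: "u \<in> D \<Longrightarrow> linear (ddX u v)"
  using has_derivative_linear has_derivative_X has_derivative_dX by blast+

lemma grad_pairing_inner: "u \<in> D \<Longrightarrow> grad_pairing u z \<bullet> v = B z (dX u v)"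
  using linear_basis_expansion[OF linear_compose[OF dX_linear bounded_linear.linear[OF B.bounded_linear_right[of z]]], of u v]
  by (simp add: grad_pairing_def inner_sum_left inner_commute[of v] mult.commute comp_def)

lemma grad_pairing_eq_0: "grad_pairing u z = 0 \<longleftrightarrow> (\<forall>e\<in>Basis. B z (dX u e) = 0)"
  by (simp add: grad_pairing_def euclidean_eq_iff[where 'a='b])

lemma plane_iff: "z \<in> P u \<longleftrightarrow> plane_map u z = 0"
  by (simp add: characteristic_plane_def plane_map_def grad_pairing_eq_0 zero_prod_def)

lemma plane_orthogonal:
  assumes "z \<in> P u" shows "B z (X u) = 0" and "u \<in> D \<Longrightarrow> B z (dX u v) = 0"
  using assms grad_pairing_inner[of u z v] by (auto simp: plane_iff plane_map_def zero_prod_def)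

lemma grad_pairing_linear: "linear (grad_pairing u)"
  unfolding grad_pairing_def
  by (rule linearI) (simp_all add: B.add_left B.scaleR_left scaleR_add_left sum.distrib scaleR_sum_right)

lemma plane_map_linear: "linear (plane_map u)"
  unfolding plane_map_def
  by (rule linearI)
    (simp_all add: B.add_left B.scaleR_left linear_add[OF grad_pairing_linear] linear_scale[OF grad_pairing_linear])

lemma plane_subspace: "subspace (P u)"
proof -
  have "P u = {z. plane_map u z = 0}" using plane_iff by blast
  then show ?thesis using linear_subspace_kernel[OF plane_map_linear[of u]] by simp
qed

text \<open>If \<open>(a, v)\<close> is orthogonal to the range, then \<open>a X u + dX u v\<close>
  is \<open>B\<close>-orthogonal to everything and hence zero; the immersion condition forces
  \<open>v = 0\<close>, and then \<open>a = 0\<close>.\<close>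

lemma plane_map_surj:
  assumes "u \<in> D" shows "surj (plane_map u)"
proof (rule ccontr)
  assume "\<not> surj (plane_map u)"
  moreover have sub: "subspace (range (plane_map u))"
    using linear_subspace_image[OF plane_map_linear subspace_UNIV] .
  ultimately have "dim (range (plane_map u)) < DIM(real \<times> 'b)"
    by (metis dim_eq_full dim_subset_UNIV le_neq_implies_less span_eq_iff)
  then obtain x where x: "x \<noteq> 0" "\<And>y. y \<in> span (range (plane_map u)) \<Longrightarrow> orthogonal x y"
    using orthogonal_to_subspace_exists by blast
  obtain a v where av: "x = (a, v)" by fastforce
  have "B z (a *\<^sub>R X u + dX u v) = 0" for z
    using x(2)[of "plane_map u z"] grad_pairing_inner[OF assms, of z v]
    by (simp add: av orthogonal_def plane_map_def span_base B.add_right B.scaleR_right inner_commute)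
  then have 0: "a *\<^sub>R X u + dX u v = 0" using nondegenerate sym by metis
  then have "dX u v = (- a) *\<^sub>R X u" by (simp add: add_eq_0_iff)
  then have "v = 0" using immersion[OF assms] by blast
  with 0 have "a = 0" using X_nonzero[OF assms] linear_0[OF dX_linear[OF assms]] by simp
  with \<open>v = 0\<close> x(1) av show False by (simp add: zero_prod_def)
qed

lemma dim_plane:
  assumes "u \<in> D" shows "dim (P u) + (1 + DIM('b)) = DIM('a)"
proof -
  have "P u = {z. plane_map u z = 0}" using plane_iff by blast
  then show ?thesis
    using dim_kernel_surj[OF plane_map_linear[of u]] plane_map_surj[OF assms] by simp
qed

lemma plane_map_tendsto:
  assumes "u \<in> D" "(f \<longlongrightarrow> u) F" "(g \<longlongrightarrow> z) F"
  shows "((\<lambda>t. plane_map (f t) (g t)) \<longlongrightarrow> plane_map u z) F"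
proof -
  have "isCont X u" "isCont (\<lambda>u. dX u v) u" for v
    using has_derivative_continuous has_derivative_X has_derivative_dX assms(1) by blast+
  then have "((\<lambda>t. X (f t)) \<longlongrightarrow> X u) F" "((\<lambda>t. dX (f t) v) \<longlongrightarrow> dX u v) F" for v
    using isCont_tendsto_compose assms(2) by blast+
  then show ?thesis
    unfolding plane_map_def grad_pairing_def
    by (intro tendsto_Pair tendsto_sum tendsto_scaleR B.tendsto assms tendsto_const)
qed

text \<open>Surjectivity of the defining equations persists near \<open>u\<close> with a uniform
  bound, so any point can be moved into a nearby plane at a cost proportional to its defect
  \<open>plane_map\<close>.\<close>

lemma plane_correction:
  assumes "u \<in> D" "(f \<longlongrightarrow> u) F"
  shows "\<exists>C>0. \<forall>\<^sub>F t in F. \<forall>z. \<exists>d. z - d \<in> P (f t) \<and> norm d \<le> C * norm (plane_map (f t) z)"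
proof -
  have "\<exists>C>0. \<forall>\<^sub>F t in F. \<forall>y. \<exists>d. plane_map (f t) d = y \<and> norm d \<le> C * norm y"
    by (rule surj_perturbation[OF always_eventually[OF allI[OF plane_map_linear]] plane_map_linear
          plane_map_surj[OF assms(1)]])
      (rule plane_map_tendsto[OF assms tendsto_const])
  then obtain C where C: "C > 0" "\<forall>\<^sub>F t in F. \<forall>y. \<exists>d. plane_map (f t) d = y \<and> norm d \<le> C * norm y"
    by blast
  have *: "z - d \<in> P v" if "plane_map v d = plane_map v z" for v z d
    using that by (simp add: plane_iff linear_diff[OF plane_map_linear])
  from C(2) have "\<forall>\<^sub>F t in F. \<forall>z. \<exists>d. z - d \<in> P (f t) \<and> norm d \<le> C * norm (plane_map (f t) z)"
    by eventually_elim (use * in metis)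
  then show ?thesis using C(1) by blast
qed

lemma plane_approach:
  assumes "u \<in> D" "z \<in> P u"
  shows "\<exists>c. (\<forall>\<^sub>F v in nhds u. c v \<in> P v) \<and> (c \<longlongrightarrow> z) (nhds u)"
proof -
  have id: "((\<lambda>v. v) \<longlongrightarrow> u) (nhds u)" by (simp add: filterlim_ident)
  obtain C where C: "\<forall>\<^sub>F v in nhds u. \<forall>z. \<exists>d. z - d \<in> P v \<and> norm d \<le> C * norm (plane_map v z)"
    using plane_correction[OF assms(1) id] by blast
  then have "\<forall>\<^sub>F v in nhds u. \<exists>d. z - d \<in> P v \<and> norm d \<le> C * norm (plane_map v z)"
    by eventually_elim blast
  then obtain d where d: "\<forall>\<^sub>F v in nhds u. z - d v \<in> P v \<and> norm (d v) \<le> C * norm (plane_map v z)"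
    unfolding eventually_ex by blast
  have "((\<lambda>v. C * norm (plane_map v z)) \<longlongrightarrow> C * norm (plane_map u z)) (nhds u)"
    by (intro tendsto_intros plane_map_tendsto[OF assms(1) id])
  then have "((\<lambda>v. C * norm (plane_map v z)) \<longlongrightarrow> 0) (nhds u)" using assms(2) by (simp add: plane_iff)
  then have "(d \<longlongrightarrow> 0) (nhds u)"
    by (rule Lim_null_comparison[rotated]) (use d in \<open>auto elim: eventually_mono\<close>)
  then have "((\<lambda>v. z - d v) \<longlongrightarrow> z - 0) (nhds u)" by (intro tendsto_intros)
  then show ?thesis using d by (intro exI[of _ "\<lambda>v. z - d v"]) (auto elim: eventually_mono)
qed

text \<open>The two equations on \<open>w\<close> say that the defect of the straight line
  \<open>q + s w\<close> with respect to the plane at \<open>u + s v\<close> has zero derivative at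
  \<open>s = 0\<close>. Correcting the line into the planes therefore keeps its velocity.\<close>

lemma plane_curve:
  assumes "u \<in> D" "q \<in> P u" "B w (X u) = 0" "grad_pairing u w + hess u q v = 0"
  shows "\<exists>c. c 0 = q \<and> (c has_derivative (\<lambda>s. s *\<^sub>R w)) (at 0) \<and>
    (\<forall>\<^sub>F s in nhds 0. u + s *\<^sub>R v \<in> D \<and> c s \<in> P (u + s *\<^sub>R v))"
proof -
  let ?f = "\<lambda>s. u + s *\<^sub>R v" and ?z = "\<lambda>s. q + s *\<^sub>R w"
  have f: "(?f has_derivative (\<lambda>s. s *\<^sub>R v)) (at 0)" "(?z has_derivative (\<lambda>s. s *\<^sub>R w)) (at 0)"
    by (auto intro!: derivative_eq_intros)
  have lim: "(?f \<longlongrightarrow> u) (nhds 0)"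
  proof -
    have "isCont ?f 0" by (intro continuous_intros)
    then show ?thesis using tendsto_at_iff_tendsto_nhds[of ?f 0] by (simp add: isCont_def)
  qed
  obtain C where "\<forall>\<^sub>F s in nhds 0. \<forall>z. \<exists>d. z - d \<in> P (?f s) \<and> norm d \<le> C * norm (plane_map (?f s) z)"
    using plane_correction[OF assms(1) lim] by blast
  then have "\<forall>\<^sub>F s in nhds 0. \<exists>d. ?z s - d \<in> P (?f s) \<and> norm d \<le> C * norm (plane_map (?f s) (?z s))"
    by eventually_elim blast
  then obtain d where d: "\<forall>\<^sub>F s in nhds 0. ?z s - d s \<in> P (?f s) \<and>
      norm (d s) \<le> C * norm (plane_map (?f s) (?z s))"
    unfolding eventually_ex by blast
  have X: "((\<lambda>s. X (?f s)) has_derivative (\<lambda>s. dX u (s *\<^sub>R v))) (at 0)"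
    using has_derivative_compose[OF f(1), of X "dX u"] has_derivative_X[OF assms(1)] by simp
  have dX: "((\<lambda>s. dX (?f s) e) has_derivative (\<lambda>s. ddX u e (s *\<^sub>R v))) (at 0)" for e
    using has_derivative_compose[OF f(1), of "\<lambda>u. dX u e" "ddX u e"] has_derivative_dX[OF assms(1)] by simp
  have "((\<lambda>s. plane_map (?f s) (?z s)) has_derivative
      (\<lambda>s. (B q (dX u (s *\<^sub>R v)) + B (s *\<^sub>R w) (X u),
        \<Sum>e\<in>Basis. (B q (ddX u e (s *\<^sub>R v)) + B (s *\<^sub>R w) (dX u e)) *\<^sub>R e))) (at 0)"
    unfolding plane_map_def grad_pairing_def
    using B.FDERIV[OF f(2) X] B.FDERIV[OF f(2) dX]
    by (intro has_derivative_Pair has_derivative_sum has_derivative_scaleR_left) simp_all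
  also have "(\<lambda>s. (B q (dX u (s *\<^sub>R v)) + B (s *\<^sub>R w) (X u),
        \<Sum>e\<in>Basis. (B q (ddX u e (s *\<^sub>R v)) + B (s *\<^sub>R w) (dX u e)) *\<^sub>R e)) =
      (\<lambda>s. (0, s *\<^sub>R (grad_pairing u w + hess u q v)))"
    using assms(3) plane_orthogonal(2)[OF assms(2,1)]
    by (simp add: linear_scale[OF ddX_linear[OF assms(1)]] B.scaleR_left B.scaleR_right
        grad_pairing_def hess_def scaleR_sum_right algebra_simps sum.distrib)
  finally have "((\<lambda>s. plane_map (?f s) (?z s)) has_derivative (\<lambda>_. 0)) (at 0)"
    using assms(4) by (simp add: zero_prod_def)
  then have "(d has_derivative (\<lambda>_. 0)) (at 0)"
    by (rule has_derivative_zero_dominated)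
      (use d assms(2) in \<open>auto simp: plane_iff elim: eventually_mono\<close>)
  from has_derivative_diff[OF f(2) this]
  have "((\<lambda>s. ?z s - d s) has_derivative (\<lambda>s. s *\<^sub>R w)) (at 0)" by simp
  moreover have "?z 0 - d 0 = q"
    using eventually_nhds_x_imp_x[OF d] assms(2) by (simp add: plane_iff)
  moreover have "\<forall>\<^sub>F s in nhds 0. ?f s \<in> D"
    using lim topological_tendstoD open_D assms(1) by blast
  ultimately show ?thesis
    using d by (intro exI[of _ "\<lambda>s. ?z s - d s"]) (auto elim: eventually_elim2)
qed

end

section \<open>Regular points of the image\<close>

lemma proportional_derivative:
  fixes g h :: "real \<Rightarrow> 'a::euclidean_space"
  assumes g: "(g has_derivative (\<lambda>s. s *\<^sub>R g')) (at 0)" and h: "(h has_derivative (\<lambda>s. s *\<^sub>R h')) (at 0)"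
    and "h 0 \<noteq> 0" "g 0 = a *\<^sub>R h 0" and ev: "\<forall>\<^sub>F s in at 0. \<exists>l. g s = l *\<^sub>R h s"
  shows "\<exists>c. g' = a *\<^sub>R h' + c *\<^sub>R h 0"
proof -
  \<comment> \<open>As a quotient of inner products the factor is differentiable at 0. Where
    \<open>h s = 0\<close>, also \<open>g s = 0\<close>, and the default value of the division does
    no harm.\<close>
  define l where "l s = (g s \<bullet> h s) / (h s \<bullet> h s)" for s
  have "l differentiable (at 0)"
    unfolding l_def using g h assms(3)
    by (intro differentiable_divide differentiable_inner) (auto simp: differentiable_def)
  then obtain l' where l': "(l has_derivative l') (at 0)" by (auto simp: differentiable_def)
  have D: "((\<lambda>s. l s *\<^sub>R h s) has_derivative (\<lambda>s. l 0 *\<^sub>R (s *\<^sub>R h') + l' s *\<^sub>R h 0)) (at 0)"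
    by (rule has_derivative_scaleR[OF l' h])
  have l0: "l 0 = a" using assms(3,4) by (simp add: l_def)
  have "\<forall>\<^sub>F s in at 0. l s *\<^sub>R h s = g s"
    using ev by eventually_elim (auto simp: l_def)
  from has_derivative_transform_eventually[OF D this] have "(g has_derivative (\<lambda>s. a *\<^sub>R (s *\<^sub>R h') + l' s *\<^sub>R h 0)) (at 0)"
    using assms(4) l0 by simp
  from has_derivative_unique[OF g this] have "g' = a *\<^sub>R h' + l' 1 *\<^sub>R h 0"
    by (metis scaleR_one)
  then show ?thesis by blast
qed

lemma hyperplane_eq_imp_proportional:
  fixes j \<nu> :: "'a::real_inner"
  assumes "j \<noteq> 0" "\<nu> \<noteq> 0" "\<And>w. j \<bullet> w = 0 \<Longrightarrow> \<nu> \<bullet> w = 0"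
  shows "\<exists>a. a \<noteq> 0 \<and> \<nu> = a *\<^sub>R j"
proof -
  let ?a = "(\<nu> \<bullet> j) / (j \<bullet> j)"
  let ?w = "\<nu> - ?a *\<^sub>R j"
  have "j \<bullet> ?w = 0" using assms(1) by (simp add: inner_diff_right inner_commute)
  then have "\<nu> \<bullet> ?w = 0" "?a *\<^sub>R j \<bullet> ?w = 0" using assms(3) by simp_all
  then have "?w \<bullet> ?w = 0" by (metis inner_diff_left diff_zero)
  then have "\<nu> = ?a *\<^sub>R j" by simp
  with assms(2) show ?thesis by (metis scaleR_zero_left)
qed

text \<open>A tangent space of codimension one leaves a single equation; its gradient is a smooth
  normal. Shrinking to where the gradient is nonzero makes all nearby points of \<open>U\<close>
  regular, so the gradient is a local lift of the Gauss map.\<close>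

lemma tangent_hyperplane_normal_field:
  fixes U :: "'a::euclidean_space set"
  assumes T: "tangent_space_at U p T" "dim T = DIM('a) - 1"
  obtains N \<nu> f where "open N" "p \<in> N" "smooth_on N \<nu>"
    "\<And>x. x \<in> N \<Longrightarrow> (f has_derivative (\<lambda>w. \<nu> x \<bullet> w)) (at x)" "\<And>x. x \<in> N \<Longrightarrow> \<nu> x \<noteq> 0"
    "\<And>x. x \<in> N \<Longrightarrow> x \<in> U \<longleftrightarrow> f x = 0"
    "\<And>q. q \<in> U \<inter> N \<Longrightarrow> tangent_space_at U q {w. \<nu> q \<bullet> w = 0}" "T = {w. \<nu> p \<bullet> w = 0}"
proof -
  obtain k N0 and f :: "nat \<Rightarrow> 'a \<Rightarrow> real" where f: "open N0" "p \<in> N0" "\<forall>i<k. smooth_on N0 (f i)"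
    "U \<inter> N0 = {x \<in> N0. \<forall>i<k. f i x = 0}" "T = {w. \<forall>i<k. frechet_derivative (f i) (at p) w = 0}"
    "dim T + k = DIM('a)"
    using T(1) unfolding tangent_space_at_def by blast
  have k: "k = 1" using f(6) T(2) DIM_positive[where 'a='a] by linarith
  define \<nu> where "\<nu> x = (\<Sum>b\<in>Basis. frechet_derivative (f 0) (at x) b *\<^sub>R b)" for x
  have Ck: "Ck_on j N0 (f 0)" for j using f(3) k by (simp add: smooth_on_def)
  have D: "(f 0 has_derivative frechet_derivative (f 0) (at x)) (at x)" if "x \<in> N0" for x
    using Ck_on_Suc_derivative Ck that by blast
  have \<nu>: "frechet_derivative (f 0) (at x) = (\<lambda>w. \<nu> x \<bullet> w)" if "x \<in> N0" for x
  proof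
    fix w
    show "frechet_derivative (f 0) (at x) w = \<nu> x \<bullet> w"
      using linear_basis_expansion[OF has_derivative_linear[OF D[OF that]], of w]
      by (simp add: \<nu>_def inner_sum_left inner_commute[of w] mult.commute)
  qed
  have "Ck_on j N0 (\<lambda>x. frechet_derivative (f 0) (at x) b)" for j b
    using Ck[of "Suc j"] by simp
  then have Ck\<nu>: "Ck_on j N0 \<nu>" for j
    unfolding \<nu>_def
    by (intro Ck_on_sum f Ck_on_bounded_linear_compose[OF bounded_linear_scaleR_left])
  have "open (N0 \<inter> \<nu> -` (- {0}))"
    using continuous_open_preimage[OF _ f(1), of \<nu> "- {0}"] Ck\<nu>[of 0] by (simp add: open_Compl)
  moreover have "p \<in> N0 \<inter> \<nu> -` (- {0})"
  proof -
    have "\<nu> p \<noteq> 0"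
    proof
      assume "\<nu> p = 0"
      then have "T = UNIV" using f(2,5) k \<nu> by simp
      then show False using f(6) k by simp
    qed
    then show ?thesis using f(2) by simp
  qed
  moreover have "smooth_on (N0 \<inter> \<nu> -` (- {0})) \<nu>"
    using Ck_on_subset[OF Ck\<nu>] by (simp add: smooth_on_def)
  moreover have "tangent_space_at U q {w. \<nu> q \<bullet> w = 0}" if "q \<in> U \<inter> (N0 \<inter> \<nu> -` (- {0}))" for q
    unfolding tangent_space_at_def
  proof (intro conjI exI)
    show "\<forall>i<1. smooth_on N0 (f i)" "U \<inter> N0 = {x \<in> N0. \<forall>i<1. f i x = 0}" using f k by auto
    show "dim {w. \<nu> q \<bullet> w = 0} + 1 = DIM('a)" using dim_hyperplane[of "\<nu> q"] that by simp
  qed (use that f \<nu> in auto)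
  moreover have "x \<in> U \<longleftrightarrow> f 0 x = 0" if "x \<in> N0 \<inter> \<nu> -` (- {0})" for x
    using f(4) k that by auto
  moreover have "T = {w. \<nu> p \<bullet> w = 0}" using f(2,5) k \<nu> by simp
  ultimately show thesis
    using that[of "N0 \<inter> \<nu> -` (- {0})" \<nu> "f 0"] D \<nu> by auto
qed

context plane_family
begin

abbreviation U :: "'a set" where "U \<equiv> darboux_image B D X"

lemma image_iff: "q \<in> U \<longleftrightarrow> q \<noteq> 0 \<and> (\<exists>u\<in>D. q \<in> P u)"
  by (auto simp: darboux_image_def)

lemma hess_linear: "u \<in> D \<Longrightarrow> linear (hess u q)"
  unfolding hess_def
  by (rule linearI) (simp_all add: linear_add[OF ddX_linear] linear_scale[OF ddX_linear]
      B.add_right B.scaleR_right scaleR_add_left sum.distrib scaleR_sum_right)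

lemma hess_add: "hess u (q + t *\<^sub>R y) v = hess u q v + t *\<^sub>R hess u y v"
  by (simp add: hess_def B.add_left B.scaleR_left scaleR_add_left sum.distrib scaleR_sum_right)

text \<open>The form is linear in the point. With a left inverse \<open>L\<close> of
  \<open>hess u y\<close>, a singular value \<open>t\<close> makes \<open>- t\<close> an eigenvalue
  of \<open>L \<circ> hess u q\<close>, and there are finitely many of these.\<close>

lemma eventually_nonfocal:
  assumes "u \<in> D" "inj (hess u y)"
  shows "\<forall>\<^sub>F t in at (0::real). inj (hess u (q + t *\<^sub>R y))"
proof -
  obtain L where L: "linear L" "L \<circ> hess u y = id"
    using linear_injective_left_inverse[OF hess_linear[OF assms(1)] assms(2)] by blast
  define S where "S = uminus ` {t. \<exists>v. v \<noteq> 0 \<and> (L \<circ> hess u q) v = t *\<^sub>R v}"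
  have "finite S"
    unfolding S_def
    by (intro finite_imageI finite_eigenvalues linear_compose hess_linear assms L)
  \<comment> \<open>The point \<open>q\<close> itself may be focal, so 0 may belong to
    \<open>S\<close>; the punctured filter ignores it.\<close>
  then have "open (- (S - {0}))" by (intro open_Compl finite_imp_closed finite_Diff)
  then have "\<forall>\<^sub>F t in at 0. t \<in> - (S - {0}) - {0}" by (intro eventually_at_in_open) auto
  then show ?thesis
  proof eventually_elim
    case (elim t)
    have "v = 0" if "hess u (q + t *\<^sub>R y) v = 0" for v
    proof (rule ccontr)
      assume "v \<noteq> 0"
      have "hess u q v = - t *\<^sub>R hess u y v" using that by (simp add: hess_add add_eq_0_iff2)
      then have "(L \<circ> hess u q) v = - t *\<^sub>R L (hess u y v)" by (simp add: linear_scale[OF L(1)] linear_neg[OF L(1)])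
      also have "L (hess u y v) = v" using L(2) by (metis comp_apply id_apply)
      finally have "t \<in> S" unfolding S_def using \<open>v \<noteq> 0\<close> by (intro image_eqI[of _ _ "- t"]) auto
      then show False using elim by blast
    qed
    then show ?case using linear_injective_0[OF hess_linear[OF assms(1)]] by blast
  qed
qed

lemma image_curve:
  assumes "u \<in> D" "q \<in> P u" "q \<in> N" "open N" "q \<noteq> 0" "B w (X u) = 0" "grad_pairing u w + hess u q v = 0"
  shows "\<exists>c. c 0 = q \<and> (c has_derivative (\<lambda>s. s *\<^sub>R w)) (at 0) \<and>
    (\<forall>\<^sub>F s in at 0. u + s *\<^sub>R v \<in> D \<and> c s \<in> P (u + s *\<^sub>R v) \<and> c s \<in> U \<inter> N)"
proof -
  obtain c where c: "c 0 = q" "(c has_derivative (\<lambda>s. s *\<^sub>R w)) (at 0)"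
    "\<forall>\<^sub>F s in nhds 0. u + s *\<^sub>R v \<in> D \<and> c s \<in> P (u + s *\<^sub>R v)"
    using plane_curve[OF assms(1,2,6,7)] by blast
  have "(c \<longlongrightarrow> q) (at 0)" using has_derivative_continuous[OF c(2)] c(1) by (simp add: isCont_def)
  then have "\<forall>\<^sub>F s in at 0. c s \<in> N - {0}"
    by (rule topological_tendstoD) (use assms in auto)
  moreover have "\<forall>\<^sub>F s in at 0. u + s *\<^sub>R v \<in> D \<and> c s \<in> P (u + s *\<^sub>R v)"
    using filter_leD[OF at_within_le_nhds c(3)] .
  ultimately have "\<forall>\<^sub>F s in at 0. u + s *\<^sub>R v \<in> D \<and> c s \<in> P (u + s *\<^sub>R v) \<and> c s \<in> U \<inter> N"
    by eventually_elim (auto simp: image_iff)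
  then show ?thesis using c by blast
qed

text \<open>At a nonfocal point every \<open>w\<close> orthogonal to \<open>X u\<close> admits a
  parameter direction \<open>v\<close> making it the velocity of a curve in the image;
  \<open>f\<close> vanishes along that curve.\<close>

lemma conormal_at_nonfocal:
  assumes "u \<in> D" "q \<in> P u" "q \<noteq> 0" "inj (hess u q)" "open N" "q \<in> N"
    and f: "\<And>x. x \<in> U \<inter> N \<Longrightarrow> f x = 0" "(f has_derivative (\<lambda>w. \<nu> \<bullet> w)) (at q)"
    and w: "B w (X u) = 0"
  shows "\<nu> \<bullet> w = 0"
proof -
  have "surj (hess u q)" using linear_injective_imp_surjective[OF hess_linear] assms by blast
  then obtain v where "hess u q v = - grad_pairing u w" by (metis surjD)
  then have "grad_pairing u w + hess u q v = 0" by simp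
  from image_curve[OF assms(1,2,6,5,3) w this] obtain c where c: "c 0 = q"
    "(c has_derivative (\<lambda>s. s *\<^sub>R w)) (at 0)"
    and ev: "\<forall>\<^sub>F s in at 0. u + s *\<^sub>R v \<in> D \<and> c s \<in> P (u + s *\<^sub>R v) \<and> c s \<in> U \<inter> N"
    by blast
  have D: "((\<lambda>s. f (c s)) has_derivative (\<lambda>s. \<nu> \<bullet> (s *\<^sub>R w))) (at 0)"
    using has_derivative_compose[OF c(2), of f "\<lambda>w. \<nu> \<bullet> w"] f(2) c(1) by simp
  have ev0: "\<forall>\<^sub>F s in at 0. f (c s) = 0" using ev by eventually_elim (simp add: f(1))
  have "f (c 0) = 0" using f(1) assms c(1) by (auto simp: image_iff)
  from has_derivative_transform_eventually[OF D ev0 this]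
  have "((\<lambda>s. 0) has_derivative (\<lambda>s. \<nu> \<bullet> (s *\<^sub>R w))) (at (0::real))" by simp
  from has_derivative_unique[OF this has_derivative_const] have "\<nu> \<bullet> (1 *\<^sub>R w) = 0" by metis
  then show ?thesis by simp
qed

end

text \<open>One nonfocal point on each plane is all that is kept of the envelope hypothesis. It is a
  condition on each plane separately and so survives shrinking of the family.\<close>

locale enveloping_family = plane_family +
  assumes nonfocal: "u \<in> D \<Longrightarrow> \<exists>q\<in>P u. inj (hess u q)"
begin

text \<open>Focal points are limits of nonfocal points of the same plane, where the tangent hyperplane
  is the polar hyperplane of \<open>X u\<close>.\<close>

lemma conormal_proportional:
  assumes "open N" "continuous_on N \<nu>" "\<And>x. x \<in> N \<Longrightarrow> (f has_derivative (\<lambda>w. \<nu> x \<bullet> w)) (at x)"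
    and "\<And>x. x \<in> N \<Longrightarrow> \<nu> x \<noteq> 0" "\<And>x. x \<in> N \<Longrightarrow> x \<in> U \<longleftrightarrow> f x = 0"
    and "q \<in> U \<inter> N" "u \<in> D" "q \<in> P u"
  shows "\<exists>a. a \<noteq> 0 \<and> \<nu> q = a *\<^sub>R J (X u)"
proof (rule hyperplane_eq_imp_proportional)
  show "J (X u) \<noteq> 0" using X_nonzero[OF assms(7)] J_inj linear_injective_0[OF J_linear] by blast
  show "\<nu> q \<noteq> 0" using assms by blast
  fix w assume "J (X u) \<bullet> w = 0"
  then have w: "B w (X u) = 0" by (metis J_inner sym)
  \<comment> \<open>The line through \<open>q\<close> in direction \<open>y\<close> stays in
    \<open>P u\<close> and consists of nonfocal points near \<open>q\<close>, except possibly
    \<open>q\<close> itself.\<close>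
  obtain y where y: "y \<in> P u" "inj (hess u y)" using nonfocal assms by blast
  let ?c = "\<lambda>t. q + t *\<^sub>R y"
  have lim: "(?c \<longlongrightarrow> q) (at 0)"
  proof -
    have "isCont ?c 0" by (intro continuous_intros)
    then show ?thesis by (simp add: isCont_def)
  qed
  have ev: "\<forall>\<^sub>F t in at 0. ?c t \<in> N - {0}"
    using lim by (rule topological_tendstoD) (use assms in \<open>auto simp: image_iff\<close>)
  have cP: "?c t \<in> P u" for t
    using plane_subspace[of u] assms(8) y(1) by (simp add: subspace_add subspace_scale)
  have "\<nu> x \<bullet> w = 0" if "x \<in> P u" "x \<in> N - {0}" "inj (hess u x)" for x
    using that assms w by (intro conormal_at_nonfocal[of u x N f]) auto
  note * = this[OF cP]
  have ev0: "\<forall>\<^sub>F t in at 0. \<nu> (?c t) \<bullet> w = 0"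
    using ev eventually_nonfocal[OF assms(7) y(2), of q] by eventually_elim (rule *)
  have "((\<lambda>t. \<nu> (?c t) \<bullet> w) \<longlongrightarrow> \<nu> q \<bullet> w) (at 0)"
  proof -
    have "isCont \<nu> q" using assms by (simp add: continuous_on_eq_continuous_at)
    from isCont_tendsto_compose[OF this lim] show ?thesis by (intro tendsto_intros)
  qed
  from Lim_transform_eventually[OF this ev0] show "\<nu> q \<bullet> w = 0"
    by (simp add: tendsto_const_iff)
qed

lemma tangent_space_image:
  assumes "p \<in> hypersurface_points U" "u \<in> D" "p \<in> P u"
  shows "tangent_space_at U p {w. B w (X u) = 0}"
proof -
  obtain T where T: "tangent_space_at U p T" "dim T = DIM('a) - 1"
    using assms(1) unfolding hypersurface_points_def regular_points_def by blast
  then have "p \<in> U" by (simp add: tangent_space_at_def)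
  obtain N f \<nu> where N: "open N" "p \<in> N" "smooth_on N \<nu>"
    "\<And>x. x \<in> N \<Longrightarrow> (f has_derivative (\<lambda>w. \<nu> x \<bullet> w)) (at x)" "\<And>x. x \<in> N \<Longrightarrow> \<nu> x \<noteq> 0"
    "\<And>x. x \<in> N \<Longrightarrow> x \<in> U \<longleftrightarrow> f x = 0"
    "\<And>q. q \<in> U \<inter> N \<Longrightarrow> tangent_space_at U q {w. \<nu> q \<bullet> w = 0}" "T = {w. \<nu> p \<bullet> w = 0}"
    by (rule tangent_hyperplane_normal_field[OF T], rule that)
  have "continuous_on N \<nu>" using N(3) by (metis Ck_on.simps(1) smooth_on_def)
  then obtain a where "a \<noteq> 0" "\<nu> p = a *\<^sub>R J (X u)"
    using conormal_proportional[OF N(1) _ N(4-6), of p u] N(2) \<open>p \<in> U\<close> assms by blast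
  then have "T = {w. B w (X u) = 0}" by (simp add: N(8) J_inner sym)
  then show ?thesis using T by simp
qed

lemma plane_generator_image:
  assumes "u \<in> D" "dim (P u) = k + 1"
  shows "plane_generator U k (P u)"
  unfolding plane_generator_def
  using assms plane_subspace tangent_space_image by (auto simp: image_iff)

text \<open>Locally the normal is a multiple of \<open>J (X u)\<close>, so its value and its
  tangential derivatives span the \<open>J\<close>-image of the span of \<open>X u\<close> and all
  \<open>dX u v\<close>. The immersion condition gives this space dimension
  \<open>DIM('b) + 1\<close>.\<close>

lemma gauss_map_rank_image:
  assumes "p \<in> hypersurface_points U"
  shows "gauss_map_rank U p DIM('b)"
proof -
  obtain T where T: "tangent_space_at U p T" "dim T = DIM('a) - 1"
    using assms(1) unfolding hypersurface_points_def regular_points_def by blast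
  then have pU: "p \<in> U" by (simp add: tangent_space_at_def)
  then obtain u where u: "u \<in> D" "p \<in> P u" "p \<noteq> 0" by (auto simp: image_iff)
  obtain N f \<nu> where N: "open N" "p \<in> N" "smooth_on N \<nu>"
    "\<And>x. x \<in> N \<Longrightarrow> (f has_derivative (\<lambda>w. \<nu> x \<bullet> w)) (at x)" "\<And>x. x \<in> N \<Longrightarrow> \<nu> x \<noteq> 0"
    "\<And>x. x \<in> N \<Longrightarrow> x \<in> U \<longleftrightarrow> f x = 0"
    "\<And>q. q \<in> U \<inter> N \<Longrightarrow> tangent_space_at U q {w. \<nu> q \<bullet> w = 0}" "T = {w. \<nu> p \<bullet> w = 0}"
    by (rule tangent_hyperplane_normal_field[OF T], rule that)
  have cont: "continuous_on N \<nu>" using N(3) by (metis Ck_on.simps(1) smooth_on_def)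
  note propor = conormal_proportional[OF N(1) cont N(4-6)]
  obtain a where a: "a \<noteq> 0" "\<nu> p = a *\<^sub>R J (X u)" using propor pU N(2) u by blast
  let ?d = "frechet_derivative \<nu> (at p)"
  have d: "(\<nu> has_derivative ?d) (at p)"
    using N(2,3) Ck_on_Suc_derivative unfolding smooth_on_def by blast
  have JX0: "J (X u) \<noteq> 0" using a N(2,5) by auto
  \<comment> \<open>Differentiate the proportionality of the normal and
    \<open>J (X (u + s v))\<close> along a curve with velocity \<open>w\<close> whose plane moves in
    direction \<open>v\<close>.\<close>
  have key: "\<exists>c. ?d w = a *\<^sub>R J (dX u v) + c *\<^sub>R J (X u)"
    if w: "B w (X u) = 0" "grad_pairing u w + hess u p v = 0" for w v
  proof -
    obtain c where c: "c 0 = p" "(c has_derivative (\<lambda>s. s *\<^sub>R w)) (at 0)"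
      "\<forall>\<^sub>F s in at 0. u + s *\<^sub>R v \<in> D \<and> c s \<in> P (u + s *\<^sub>R v) \<and> c s \<in> U \<inter> N"
      using image_curve[OF u(1,2) N(2,1) u(3) w] by blast
    have 1: "((\<lambda>s. \<nu> (c s)) has_derivative (\<lambda>s. s *\<^sub>R ?d w)) (at 0)"
      using has_derivative_compose[OF c(2), of \<nu> ?d] d c(1)
      by (simp add: linear_scale[OF has_derivative_linear[OF d]])
    have 2: "((\<lambda>s. J (X (u + s *\<^sub>R v))) has_derivative (\<lambda>s. s *\<^sub>R J (dX u v))) (at 0)"
    proof -
      have "((\<lambda>s. u + s *\<^sub>R v) has_derivative (\<lambda>s. s *\<^sub>R v)) (at 0)"
        by (auto intro!: derivative_eq_intros)
      from has_derivative_compose[OF this, of X "dX u"] has_derivative_X[OF u(1)]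
      have "((\<lambda>s. X (u + s *\<^sub>R v)) has_derivative (\<lambda>s. s *\<^sub>R dX u v)) (at 0)"
        by (simp add: linear_scale[OF dX_linear[OF u(1)]])
      from bounded_linear.has_derivative[OF _ this, of J] show ?thesis
        using J_linear by (simp add: linear_scale[OF J_linear] linear_conv_bounded_linear[symmetric])
    qed
    have "\<forall>\<^sub>F s in at 0. \<exists>l. \<nu> (c s) = l *\<^sub>R J (X (u + s *\<^sub>R v))"
      using c(3) by eventually_elim (use propor in blast)
    from proportional_derivative[OF 1 2 _ _ this, of a] show ?thesis using a(2) c(1) JX0 by simp
  qed
  define K where "K = (\<lambda>(c::real, v). J (c *\<^sub>R X u + dX u v))"
  have K: "K (c, v) = c *\<^sub>R J (X u) + J (dX u v)" for c v
    by (simp add: K_def linear_add[OF J_linear] linear_scale[OF J_linear])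
  have Klin: "linear K"
  proof (rule linearI)
    fix x y :: "real \<times> 'b" and r :: real
    show "K (x + y) = K x + K y"
      by (cases x; cases y) (simp add: K scaleR_add_left linear_add[OF dX_linear[OF u(1)]] linear_add[OF J_linear])
    show "K (r *\<^sub>R x) = r *\<^sub>R K x"
      by (cases x) (simp add: K scaleR_add_right linear_scale[OF dX_linear[OF u(1)]] linear_scale[OF J_linear])
  qed
  have Kinj: "c = 0 \<and> v = 0" if "K (c, v) = 0" for c v
  proof -
    have *: "c *\<^sub>R X u + dX u v = 0"
      using that linear_injective_0[OF J_linear] J_inj by (simp add: K_def)
    then have "dX u v = (- c) *\<^sub>R X u" by (simp add: add_eq_0_iff)
    then have "v = 0" using immersion u(1) by blast
    with * show ?thesis using X_nonzero[OF u(1)] linear_0[OF dX_linear[OF u(1)]] by simp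
  qed
  have "inj K" using linear_injective_0[OF Klin] Kinj by (auto simp: zero_prod_def)
  \<comment> \<open>Regular points are nonfocal: for \<open>v\<close> in the kernel of the form,
    \<open>w = 0\<close> is admissible in \<open>key\<close>, and its left side is then
    zero.\<close>
  have "v = 0" if hv: "hess u p v = 0" for v
  proof -
    from key[of 0 v] obtain c where "K (c, a *\<^sub>R v) = 0"
      using hv linear_0[OF grad_pairing_linear] linear_0[OF has_derivative_linear[OF d]]
      by (auto simp: K B.zero_left linear_scale[OF dX_linear[OF u(1)]] linear_scale[OF J_linear] add.commute)
    then show ?thesis using Kinj a(1) by fastforce
  qed
  then have "surj (hess u p)"
    using linear_injective_imp_surjective[OF hess_linear[OF u(1)]] linear_injective_0[OF hess_linear[OF u(1)]]
    by blast
  let ?S = "insert (\<nu> p) (?d ` {w. \<nu> p \<bullet> w = 0})"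
  have "?S \<subseteq> range K"
  proof -
    have "\<nu> p = K (a, 0)"
      by (simp add: K a(2) linear_0[OF dX_linear[OF u(1)]] linear_0[OF J_linear])
    moreover have "?d w \<in> range K" if "\<nu> p \<bullet> w = 0" for w
    proof -
      have w: "B w (X u) = 0" using that a by (simp add: J_inner sym)
      obtain v where "hess u p v = - grad_pairing u w" using \<open>surj (hess u p)\<close> by (metis surjD)
      then obtain c where "?d w = K (c, a *\<^sub>R v)"
        using key[OF w, of v]
        by (auto simp: K linear_scale[OF dX_linear[OF u(1)]] linear_scale[OF J_linear] add.commute)
      then show ?thesis by blast
    qed
    ultimately show ?thesis by auto
  qed
  moreover have "range K \<subseteq> span ?S"
  proof clarify
    fix c v
    \<comment> \<open>This \<open>w\<close> is tangent to the image and is the velocity of a curve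
      along which the parameter moves in direction \<open>v\<close>.\<close>
    obtain w where w: "plane_map u w = (0, - hess u p v)" using plane_map_surj[OF u(1)] by (metis surjD)
    then have w': "B w (X u) = 0" "grad_pairing u w + hess u p v = 0" by (auto simp: plane_map_def)
    then obtain e where e: "?d w = a *\<^sub>R J (dX u v) + e *\<^sub>R J (X u)" using key by blast
    have "\<nu> p \<bullet> w = 0" using w'(1) by (simp add: a(2) J_inner sym)
    then have "?d w \<in> span ?S" "\<nu> p \<in> span ?S" by (auto intro: span_base)
    \<comment> \<open>Solve \<open>e\<close> for \<open>J (dX u v)\<close> and replace
      \<open>J (X u)\<close> by \<open>\<nu> p\<close> divided by \<open>a\<close>.\<close>
    moreover have "K (c, v) = (1 / a) *\<^sub>R ?d w + ((c - e / a) / a) *\<^sub>R \<nu> p"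
      using a by (simp add: K e algebra_simps) (simp add: field_simps flip: scaleR_add_left)
    ultimately show "K (c, v) \<in> span ?S" by (simp add: span_add span_scale)
  qed
  ultimately have "span ?S = range K"
    using linear_subspace_image[OF Klin subspace_UNIV] by (intro subset_antisym span_minimal)
  then have "dim ?S = dim (range K)" by (metis dim_span)
  also have "\<dots> = DIM('b) + 1"
    using dim_image_eq[OF Klin, of UNIV] \<open>inj K\<close> by simp
  finally show ?thesis
    unfolding gauss_map_rank_def using N pU by blast
qed

lemma tangentially_degenerate_image:
  assumes "DIM('b) < DIM('a) - 2"
  shows "tangentially_degenerate U DIM('b)"
  using assms gauss_map_rank_image by (simp add: tangentially_degenerate_def)

end

section \<open>Existence of regular points\<close>

context plane_family
begin

text \<open>Near a nonfocal point \<open>y\<close> the equations \<open>B z (dX u e) = 0\<close> determine \<open>u = \<phi> z\<close>.\<close>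

lemma implicit_parameter:
  assumes "u0 \<in> D" "y \<in> P u0" "inj (hess u0 y)"
  obtains V A C \<phi> \<phi>' where "open V" "open A" "open C" "y \<in> A" "u0 \<in> C"
    "\<And>z u. z \<in> A \<Longrightarrow> u \<in> C \<Longrightarrow> u \<in> D \<and> (grad_pairing u z = 0 \<longrightarrow> z \<in> V \<and> \<phi> z = u)"
    "\<And>z. z \<in> V \<Longrightarrow> \<phi> z \<in> D \<and> grad_pairing (\<phi> z) z = 0 \<and> inj (hess (\<phi> z) z)"
    "\<And>z. z \<in> V \<Longrightarrow> (\<phi> has_derivative \<phi>' z) (at z)"
    "\<And>z w. z \<in> V \<Longrightarrow> hess (\<phi> z) z (\<phi>' z w) = - grad_pairing (\<phi> z) w"
proof -
  \<comment> \<open>Carrying \<open>z\<close> along reduces the implicit equation to the inverse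
    function theorem; the derivative is block triangular with diagonal blocks the identity and
    \<open>hess u z\<close>.\<close>
  define F where "F = (\<lambda>(z, u). (z, grad_pairing u z))"
  define F' where "F' = (\<lambda>(z, u). \<lambda>(w, v). (w, grad_pairing u w + hess u z v))"
  let ?W = "(UNIV :: 'a set) \<times> D"
  have F_der: "(F has_derivative F' x) (at x)" if xW: "x \<in> ?W" for x
  proof -
    obtain z u where x: "x = (z, u)" and u: "u \<in> D" using xW by auto
    have 1: "((\<lambda>x. dX (snd x) e) has_derivative (\<lambda>h. ddX u e (snd h))) (at x)" for e
      using has_derivative_compose[OF has_derivative_snd[OF has_derivative_ident], of "\<lambda>u. dX u e" "ddX u e" x]
        has_derivative_dX[OF u] x by simp
    have "((\<lambda>x. (fst x, \<Sum>e\<in>Basis. B (fst x) (dX (snd x) e) *\<^sub>R e)) has_derivative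
        (\<lambda>h. (fst h, \<Sum>e\<in>Basis. (B (fst x) (ddX u e (snd h)) + B (fst h) (dX (snd x) e)) *\<^sub>R e))) (at x)"
      by (intro has_derivative_Pair has_derivative_sum has_derivative_scaleR_left
          B.FDERIV 1 has_derivative_fst has_derivative_ident)
    moreover have "F = (\<lambda>x. (fst x, \<Sum>e\<in>Basis. B (fst x) (dX (snd x) e) *\<^sub>R e))"
      by (auto simp: F_def grad_pairing_def)
    moreover have "F' x = (\<lambda>h. (fst h, \<Sum>e\<in>Basis. (B (fst x) (ddX u e (snd h)) + B (fst h) (dX (snd x) e)) *\<^sub>R e))"
      by (auto simp: F'_def x grad_pairing_def hess_def scaleR_add_left sum.distrib add.commute)
    ultimately show ?thesis by simp
  qed
  \<comment> \<open>The inverse function theorem wants the derivative as a continuous map into the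
    bounded linear operators.\<close>
  define f' where "f' x = Blinfun (F' x)" for x
  have f': "blinfun_apply (f' x) = F' x" if "x \<in> ?W" for x
    unfolding f'_def using F_der[OF that] bounded_linear_Blinfun_apply has_derivative_bounded_linear by blast
  have cont: "continuous_on ?W f'"
  proof (rule continuous_on_blinfun_componentwise)
    fix i :: "'a \<times> 'b"
    obtain w v where i: "i = (w, v)" by fastforce
    have "continuous_on ?W (\<lambda>x. dX (snd x) e)" "continuous_on ?W (\<lambda>x. ddX (snd x) e v)" for e
      using Ck_dX[of 0 e] Ck_ddX[of 0 e v]
      by (auto intro!: continuous_on_compose2[of D _ ?W snd] continuous_intros)
    then have "continuous_on ?W (\<lambda>x. (w, (\<Sum>e\<in>Basis. B w (dX (snd x) e) *\<^sub>R e) +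
        (\<Sum>e\<in>Basis. B (fst x) (ddX (snd x) e v) *\<^sub>R e)))"
      by (intro continuous_intros B.continuous_on) auto
    then have "continuous_on ?W (\<lambda>x. F' x i)"
      by (simp add: F'_def i grad_pairing_def hess_def case_prod_beta)
    then show "continuous_on ?W (\<lambda>x. blinfun_apply (f' x) i)"
      using f' by (simp cong: continuous_on_cong)
  qed
  have W: "(y, u0) \<in> ?W" "open ?W" using assms(1) open_D by (auto intro: open_Times)
  have F'lin: "linear (F' x)" if "x \<in> ?W" for x
    using F_der[OF that] has_derivative_linear by blast
  have "inj (F' (y, u0))"
    unfolding linear_injective_0[OF F'lin[OF W(1)]]
    using assms(3) linear_injective_0[OF hess_linear[OF assms(1)]] linear_0[OF grad_pairing_linear]
    by (auto simp: F'_def zero_prod_def)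
  then obtain L where L: "linear L" "L \<circ> F' (y, u0) = id"
    using linear_injective_left_inverse[OF F'lin[OF W(1)]] by blast
  have Lap: "blinfun_apply (Blinfun L) = L"
    using L(1) bounded_linear_Blinfun_apply linear_conv_bounded_linear by blast
  have inv: "Blinfun L o\<^sub>L f' (y, u0) = id_blinfun"
  proof (rule blinfun_eqI)
    fix i
    have "L (F' (y, u0) i) = i" using L(2) by (metis comp_apply id_apply)
    then show "blinfun_apply (Blinfun L o\<^sub>L f' (y, u0)) i = blinfun_apply id_blinfun i"
      using f'[OF W(1)] Lap by simp
  qed
  have F_der': "(F has_derivative blinfun_apply (f' x)) (at x)" if "x \<in> ?W" for x
    using F_der f' that by simp
  obtain U' V' g g' where g: "open U'" "U' \<subseteq> ?W" "(y, u0) \<in> U'" "open V'" "F (y, u0) \<in> V'"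
    "homeomorphism U' V' F g" "\<And>y. y \<in> V' \<Longrightarrow> (g has_derivative (g' y)) (at y)"
    "\<And>y. y \<in> V' \<Longrightarrow> g' y = inv (blinfun_apply (f' (g y)))"
    "\<And>y. y \<in> V' \<Longrightarrow> bij (blinfun_apply (f' (g y)))"
    using inverse_function_theorem[OF W(2) F_der' cont W(1) inv] by metis
  obtain A C where AC: "open A" "open C" "(y, u0) \<in> A \<times> C" "A \<times> C \<subseteq> U'"
    using open_prod_elim[OF g(1,3)] by metis
  \<comment> \<open>The slice of the target on which \<open>grad_pairing\<close> takes the value
    0.\<close>
  define V where "V = {z. (z, 0) \<in> V'}"
  define \<phi> where "\<phi> z = snd (g (z, 0))" for z
  define \<phi>' where "\<phi>' z w = snd (g' (z, 0) (w, 0))" for z w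
  have V_open: "open V"
    using open_vimage[OF g(4), of "\<lambda>z. (z, 0)"] by (simp add: V_def vimage_def continuous_intros)
  have FgV: "F (g x) = x" "g x \<in> U'" if "x \<in> V'" for x
    using g(6) that by (auto simp: homeomorphism_def)
  have gz: "g (z, 0) = (z, \<phi> z)" "\<phi> z \<in> D" "grad_pairing (\<phi> z) z = 0" if "z \<in> V" for z
  proof -
    have *: "F (g (z, 0)) = (z, 0)" "g (z, 0) \<in> ?W"
      using FgV[of "(z, 0)"] g(2) that by (auto simp: V_def)
    then show "g (z, 0) = (z, \<phi> z)" "\<phi> z \<in> D" "grad_pairing (\<phi> z) z = 0"
      by (auto simp: F_def \<phi>_def split_def prod_eq_iff)
  qed
  have zW: "(z, \<phi> z) \<in> ?W" if "z \<in> V" for z using gz(2)[OF that] by simp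
  have bij: "bij (F' (z, \<phi> z))" and g'z: "g' (z, 0) = inv (F' (z, \<phi> z))" if "z \<in> V" for z
    using g(8,9)[of "(z, 0)"] f'[OF zW[OF that]] gz(1)[OF that] that by (simp_all add: V_def)
  show thesis
  proof (rule that[of V A C \<phi> \<phi>'])
    show "open V" "open A" "open C" "y \<in> A" "u0 \<in> C" using V_open AC by auto
    show "u \<in> D \<and> (grad_pairing u z = 0 \<longrightarrow> z \<in> V \<and> \<phi> z = u)" if "z \<in> A" "u \<in> C" for z u
    proof -
      have zu: "(z, u) \<in> U'" using AC that by blast
      have "z \<in> V \<and> \<phi> z = u" if "grad_pairing u z = 0"
      proof -
        have "F (z, u) = (z, 0)" using that by (simp add: F_def)
        then have "(z, 0) \<in> V'" "g (z, 0) = (z, u)"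
          using g(6) zu by (auto simp: homeomorphism_def) (metis image_eqI)
        then show ?thesis by (simp add: V_def \<phi>_def)
      qed
      then show ?thesis using zu g(2) by auto
    qed
    show "\<phi> z \<in> D \<and> grad_pairing (\<phi> z) z = 0 \<and> inj (hess (\<phi> z) z)" if "z \<in> V" for z
    proof -
      have "v = 0" if "hess (\<phi> z) z v = 0" for v
      proof -
        have "F' (z, \<phi> z) (0, v) = F' (z, \<phi> z) (0, 0)"
          using that linear_0[OF hess_linear[OF gz(2)[OF \<open>z \<in> V\<close>]]] by (simp add: F'_def)
        then show ?thesis using bij[OF \<open>z \<in> V\<close>] by (auto dest!: bij_is_inj injD)
      qed
      then have "inj (hess (\<phi> z) z)" using linear_injective_0[OF hess_linear[OF gz(2)[OF that]]] by blast
      then show ?thesis using gz[OF that] by blast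
    qed
    show "(\<phi> has_derivative \<phi>' z) (at z)" if "z \<in> V" for z
    proof -
      have "((\<lambda>z. (z, 0::'b)) has_derivative (\<lambda>w. (w, 0))) (at z)"
        by (intro has_derivative_Pair has_derivative_ident has_derivative_const)
      from has_derivative_snd[OF has_derivative_compose[OF this g(7)]] that
      show ?thesis by (simp add: \<phi>_def[abs_def] \<phi>'_def[abs_def] V_def)
    qed
    show "hess (\<phi> z) z (\<phi>' z w) = - grad_pairing (\<phi> z) w" if "z \<in> V" for z w
    proof -
      have "F' (z, \<phi> z) (g' (z, 0) (w, 0)) = (w, 0)"
        using bij[OF that] g'z[OF that] by (simp add: bij_is_surj surj_f_inv_f)
      moreover obtain a b where ab: "g' (z, 0) (w, 0) = (a, b)" by fastforce
      ultimately have "a = w" "grad_pairing (\<phi> z) a + hess (\<phi> z) z b = 0" by (auto simp: F'_def)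
      then show ?thesis by (simp add: \<phi>'_def ab add_eq_0_iff)
    qed
  qed
qed

text \<open>Bootstrapping: the derivative of \<open>\<phi>\<close> solves a linear system whose
  coefficients are as smooth as \<open>\<phi>\<close>, so each order of smoothness yields the
  next.\<close>

lemma implicit_parameter_smooth:
  assumes "open V" "\<And>z. z \<in> V \<Longrightarrow> \<phi> z \<in> D \<and> inj (hess (\<phi> z) z)"
    and "\<And>z. z \<in> V \<Longrightarrow> (\<phi> has_derivative \<phi>' z) (at z)"
    and "\<And>z w. z \<in> V \<Longrightarrow> hess (\<phi> z) z (\<phi>' z w) = - grad_pairing (\<phi> z) w"
  shows "Ck_on k V \<phi>"
proof (induction k)
  case 0
  have "isCont \<phi> z" if "z \<in> V" for z using has_derivative_continuous[OF assms(3)[OF that]] .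
  then show ?case using assms(1) by (simp add: continuous_on_eq_continuous_at)
next
  case (Suc k)
  have comp: "Ck_on k V (\<lambda>z. f (\<phi> z))" if "Ck_on k D f" for f :: "'b \<Rightarrow> 'a"
    by (rule Ck_on_compose[OF assms(1) that Suc]) (use assms(2) in blast)
  show ?case
  proof (rule Ck_on_SucI[OF assms(1,3)])
    fix w
    show "Ck_on k V (\<lambda>z. \<phi>' z w)"
    proof (rule Ck_on_linear_solve[OF assms(1), where A="\<lambda>z. hess (\<phi> z) z" and b="\<lambda>z. - grad_pairing (\<phi> z) w"])
      show "Ck_on k V (\<lambda>z. hess (\<phi> z) z v)" for v
        unfolding hess_def
        by (intro Ck_on_sum Ck_on_bounded_linear_compose[OF bounded_linear_scaleR_left]
            Ck_on_bounded_bilinear[OF bounded_bilinear] Ck_on_ident comp Ck_ddX assms(1))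
      show "Ck_on k V (\<lambda>z. - grad_pairing (\<phi> z) w)"
        unfolding grad_pairing_def
        by (intro Ck_on_bounded_linear_compose[OF bounded_linear_minus[OF bounded_linear_ident]]
            Ck_on_sum Ck_on_bounded_linear_compose[OF bounded_linear_scaleR_left]
            Ck_on_bounded_bilinear[OF bounded_bilinear] Ck_on_const comp Ck_dX assms(1))
    qed (use assms hess_linear in auto)
  qed
qed

text \<open>Other sheets of the image may pass through a point of a large family, so the parameters
  are restricted to where \<open>\<phi>\<close> is the only solution. There the image is the zero
  set of \<open>g\<close>, whose differential is \<open>B\<close>-pairing with the nonzero vector
  \<open>X (\<phi> z)\<close>.\<close>

lemma locally_regular_points:
  assumes "u0 \<in> D" "y \<in> P u0" "inj (hess u0 y)"
  shows "\<exists>D0. open D0 \<and> u0 \<in> D0 \<and> D0 \<subseteq> D \<and> (\<forall>D'. open D' \<and> D' \<subseteq> D0 \<longrightarrow>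
    (\<forall>u\<in>D'. P u \<inter> hypersurface_points (darboux_image B D' X) \<noteq> {}))"
proof -
  obtain V A C \<phi> \<phi>' where V: "open V" and A: "open A" and C: "open C" and y: "y \<in> A" and u0: "u0 \<in> C"
    and AC: "\<And>z u. z \<in> A \<Longrightarrow> u \<in> C \<Longrightarrow> u \<in> D \<and> (grad_pairing u z = 0 \<longrightarrow> z \<in> V \<and> \<phi> z = u)"
    and \<phi>: "\<And>z. z \<in> V \<Longrightarrow> \<phi> z \<in> D \<and> grad_pairing (\<phi> z) z = 0 \<and> inj (hess (\<phi> z) z)"
    and \<phi>': "\<And>z. z \<in> V \<Longrightarrow> (\<phi> has_derivative \<phi>' z) (at z)"
    and eq: "\<And>z w. z \<in> V \<Longrightarrow> hess (\<phi> z) z (\<phi>' z w) = - grad_pairing (\<phi> z) w"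
    by (rule implicit_parameter[OF assms], rule that)
  have Ck\<phi>: "Ck_on k V \<phi>" for k using implicit_parameter_smooth[OF V _ \<phi>' eq] \<phi> by blast
  \<comment> \<open>The form vanishes at the origin and \<open>'b\<close> has positive dimension, so
    the origin is focal.\<close>
  have "y \<noteq> 0"
  proof
    assume "y = 0"
    obtain e where "e \<in> (Basis :: 'b set)" using nonempty_Basis by blast
    moreover have "hess u0 y e = hess u0 y 0" using \<open>y = 0\<close> by (simp add: hess_def B.zero_left)
    ultimately show False using assms(3) by (metis injD nonzero_Basis)
  qed
  obtain c where c: "\<forall>\<^sub>F v in nhds u0. c v \<in> P v" "(c \<longlongrightarrow> y) (nhds u0)"
    using plane_approach[OF assms(1,2)] by blast
  have "\<forall>\<^sub>F v in nhds u0. c v \<in> A - {0}"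
    using c(2) by (rule topological_tendstoD) (use A y \<open>y \<noteq> 0\<close> in auto)
  with c(1) have "\<forall>\<^sub>F v in nhds u0. c v \<in> P v \<and> c v \<in> A - {0}" by eventually_elim simp
  then obtain S where S: "open S" "u0 \<in> S" "\<And>v. v \<in> S \<Longrightarrow> c v \<in> P v \<and> c v \<in> A - {0}"
    unfolding eventually_nhds by metis
  have "\<forall>u\<in>D'. P u \<inter> hypersurface_points (darboux_image B D' X) \<noteq> {}"
    if D': "open D'" "D' \<subseteq> C \<inter> S" for D'
  proof
    fix u assume u: "u \<in> D'"
    let ?U = "darboux_image B D' X"
    \<comment> \<open>Only points whose parameter \<open>\<phi> z\<close> lies in \<open>D'\<close>
      are kept, so that zeros of \<open>g\<close> in \<open>N\<close> belong to the image of the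
      smaller family.\<close>
    define N where "N = (V \<inter> \<phi> -` D') \<inter> (A - {0})"
    have "continuous_on V \<phi>" using Ck\<phi>[of 0] by simp
    then have "open (V \<inter> \<phi> -` D')" using continuous_open_preimage[OF _ V D'(1)] by blast
    then have N: "open N" unfolding N_def using A by blast
    define g where "g z = B z (X (\<phi> z))" for z
    have g': "(g has_derivative (\<lambda>w. B w (X (\<phi> z)))) (at z)" if "z \<in> V" for z
    proof -
      have "((\<lambda>z. X (\<phi> z)) has_derivative (\<lambda>w. dX (\<phi> z) (\<phi>' z w))) (at z)"
        using has_derivative_compose[OF \<phi>'[OF that] has_derivative_X] \<phi>[OF that] by blast
      from B.FDERIV[OF has_derivative_ident this]
      have "(g has_derivative (\<lambda>w. B z (dX (\<phi> z) (\<phi>' z w)) + B w (X (\<phi> z)))) (at z)"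
        by (simp add: g_def[abs_def])
      \<comment> \<open>The envelope effect: the motion of the parameter contributes nothing,
        because \<open>\<phi> z\<close> is a critical point of
        \<open>u \<mapsto> B z (X u)\<close>.\<close>
      moreover have "B z (dX (\<phi> z) (\<phi>' z w)) = 0" for w
        using grad_pairing_inner[of "\<phi> z" z "\<phi>' z w"] \<phi>[OF that] by simp
      ultimately show ?thesis by simp
    qed
    have "Ck_on k V (\<lambda>z. X (\<phi> z))" for k
      by (rule Ck_on_compose[OF V Ck_X Ck\<phi>]) (use \<phi> in blast)
    then have "Ck_on k V g" for k
      unfolding g_def[abs_def] by (intro Ck_on_bounded_bilinear[OF bounded_bilinear] Ck_on_ident V)
    then have g_smooth: "smooth_on N g"
      unfolding smooth_on_def N_def using Ck_on_subset by blast
    have UN: "?U \<inter> N = {x \<in> N. g x = 0}"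
    proof (intro subset_antisym subsetI)
      fix x assume x: "x \<in> ?U \<inter> N"
      then obtain v where v: "v \<in> D'" "x \<in> P v" by (auto simp: darboux_image_def)
      then have "\<phi> x = v" using AC[of x v] x D'(2) by (auto simp: N_def plane_iff plane_map_def zero_prod_def)
      then show "x \<in> {x \<in> N. g x = 0}" using x v plane_orthogonal(1) by (simp add: g_def)
    next
      fix x assume "x \<in> {x \<in> N. g x = 0}"
      then show "x \<in> ?U \<inter> N"
        using \<phi>[of x] by (auto simp: darboux_image_def N_def g_def plane_iff plane_map_def zero_prod_def)
    qed
    have cu: "c u \<in> P u" "c u \<in> A - {0}" using S(3) u D'(2) by auto
    then have "c u \<in> V" "\<phi> (c u) = u"
      using AC[of "c u" u] u D'(2) by (auto simp: plane_iff plane_map_def zero_prod_def)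
    then have cN: "c u \<in> N" using u cu(2) by (simp add: N_def)
    have cU: "c u \<in> ?U" using cu u by (auto simp: darboux_image_def)
    have uD: "u \<in> D" using \<phi>[OF \<open>c u \<in> V\<close>] \<open>\<phi> (c u) = u\<close> by simp
    let ?T = "{w. B w (X u) = 0}"
    have "J (X u) \<noteq> 0" using X_nonzero[OF uD] J_inj linear_injective_0[OF J_linear] by blast
    then have dimT: "dim ?T = DIM('a) - 1"
      using dim_hyperplane[of "J (X u)"] by (simp add: J_inner sym)
    have fd: "frechet_derivative g (at (c u)) = (\<lambda>w. B w (X u))"
      using frechet_derivative_at[OF g'[OF \<open>c u \<in> V\<close>]] \<open>\<phi> (c u) = u\<close> by simp
    have "tangent_space_at ?U (c u) ?T"
      unfolding tangent_space_at_def
    proof (intro conjI exI)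
      show "open N" "c u \<in> N" "c u \<in> ?U" by fact+
      show "\<forall>i<1. smooth_on N ((\<lambda>_::nat. g) i)" using g_smooth by simp
      show "?U \<inter> N = {x \<in> N. \<forall>i<1. (\<lambda>_::nat. g) i x = 0}" using UN by auto
      show "?T = {w. \<forall>i<1. frechet_derivative ((\<lambda>_::nat. g) i) (at (c u)) w = 0}" using fd by simp
      show "dim ?T + 1 = DIM('a)" using dimT DIM_positive[where 'a='a] by linarith
    qed
    then have "c u \<in> hypersurface_points ?U"
      using dimT by (auto simp: hypersurface_points_def regular_points_def)
    then show "P u \<inter> hypersurface_points ?U \<noteq> {}" using cu(1) by blast
  qed
  moreover have "C \<inter> S \<subseteq> D" using AC y by blast
  ultimately show ?thesis using C S u0 by (intro exI[of _ "C \<inter> S"]) auto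
qed

end

section \<open>Canal hypersurfaces have nonfocal points on every characteristic\<close>

text \<open>Split \<open>x\<close> into its positive part \<open>a\<close> and negative part
  \<open>b\<close>; both lie in \<open>S\<close>, and pairing \<open>x\<close> with each leaves
  \<open>B a a = 0\<close> and \<open>B b b = 0\<close>.\<close>

lemma has_signature_nondegenerate:
  assumes "has_signature B S p q" "bilinear B" "\<And>x y. B x y = B y x"
    and "x \<in> S" "\<And>y. y \<in> S \<Longrightarrow> B x y = 0"
  shows "x = 0"
proof -
  obtain P N where PN: "subspace P" "subspace N" "S = span (P \<union> N)"
    "\<And>x y. x \<in> P \<Longrightarrow> y \<in> N \<Longrightarrow> B x y = 0"
    "\<And>x. x \<in> P \<Longrightarrow> x \<noteq> 0 \<Longrightarrow> B x x > 0" "\<And>y. y \<in> N \<Longrightarrow> y \<noteq> 0 \<Longrightarrow> B y y < 0"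
    using assms(1) unfolding has_signature_def by blast
  obtain a b where ab: "x = a + b" "a \<in> P" "b \<in> N"
    using assms(4) PN(1-3) by (auto simp: span_Un span_eq_iff[THEN iffD2])
  have "a \<in> S" "b \<in> S" using ab PN(3) by (auto intro: span_base)
  then have "B a a + B b a = 0" "B a b + B b b = 0"
    using assms(5) ab(1) by (auto simp: bilinear_ladd[OF assms(2)])
  then have "B a a = 0" "B b b = 0" using PN(4)[OF ab(2,3)] assms(3)[of a b] by auto
  then have "a = 0" "b = 0" using PN(5)[OF ab(2)] PN(6)[OF ab(3)] by auto
  then show ?thesis using ab by simp
qed

context plane_family
begin

text \<open>The curve in the plane family is pushed back onto the quadric along a field \<open>t\<close> transversal
  to it; the correction \<open>x\<close> is the small root of \<open>B (c0 + x t) (c0 + x t) = 0\<close>.\<close>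

lemma null_curve:
  assumes "u \<in> D" "y \<in> P u" "y \<noteq> 0" "B y y = 0" "hess u y v = 0"
    and nondeg: "\<And>z. z \<in> P u \<Longrightarrow> (\<And>w. w \<in> P u \<Longrightarrow> B z w = 0) \<Longrightarrow> z = 0"
  shows "\<exists>c. c 0 = y \<and> (c has_derivative (\<lambda>_. 0)) (at 0) \<and>
    (\<forall>\<^sub>F s in nhds 0. u + s *\<^sub>R v \<in> D \<and> c s \<in> characteristic B X (u + s *\<^sub>R v))"
proof -
  let ?f = "\<lambda>s. u + s *\<^sub>R v"
  have nhds_lim: "(h \<longlongrightarrow> h 0) (nhds 0)" if "isCont h 0" for h :: "real \<Rightarrow> 'z::real_normed_vector"
    using that tendsto_at_iff_tendsto_nhds[of h 0] by (simp add: isCont_def)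
  have "isCont ?f 0" by (intro continuous_intros)
  from nhds_lim[OF this] have f: "(?f \<longlongrightarrow> u) (nhds 0)" by simp
  obtain c0 where c0: "c0 0 = y" "(c0 has_derivative (\<lambda>_. 0)) (at 0)"
    "\<forall>\<^sub>F s in nhds 0. ?f s \<in> D \<and> c0 s \<in> P (?f s)"
    using plane_curve[OF assms(1,2), of 0 v] assms(5) linear_0[OF grad_pairing_linear]
    by (auto simp: B.zero_left)
  \<comment> \<open>Nondegeneracy on \<open>P u\<close> gives a direction not orthogonal to
    \<open>y\<close>; its sign is chosen to keep the denominator of \<open>x\<close> below away from
    zero.\<close>
  obtain \<tau> where \<tau>: "\<tau> \<in> P u" "B y \<tau> > 0"
  proof -
    obtain w where w: "w \<in> P u" "B y w \<noteq> 0" using nondeg[OF assms(2)] assms(3) by blast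
    then have "- w \<in> P u" using plane_subspace subspace_neg by blast
    then show thesis using that[of w] that[of "- w"] w by (cases "B y w > 0") (auto simp: B.minus_right)
  qed
  obtain c1 where c1: "\<forall>\<^sub>F u' in nhds u. c1 u' \<in> P u'" "(c1 \<longlongrightarrow> \<tau>) (nhds u)"
    using plane_approach[OF assms(1) \<tau>(1)] by blast
  define t where "t s = c1 (?f s)" for s
  have t: "(t \<longlongrightarrow> \<tau>) (nhds 0)" "\<forall>\<^sub>F s in nhds 0. t s \<in> P (?f s)"
    unfolding t_def using filterlim_compose[OF c1(2) f] eventually_compose_filterlim[OF c1(1) f] by auto
  have c0lim: "(c0 \<longlongrightarrow> y) (nhds 0)" using nhds_lim[OF has_derivative_continuous[OF c0(2)]] c0(1) by simp
  define e b a where "e s = B (c0 s) (c0 s)" and "b s = B (c0 s) (t s)" and "a s = B (t s) (t s)" for s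
  \<comment> \<open>The rationalised quadratic formula: it never divides by \<open>a s\<close>,
    which may vanish, and shows that \<open>x\<close> is of the size of \<open>e\<close>.\<close>
  define x where "x s = - e s / (b s + sqrt ((b s)\<^sup>2 - e s * a s))" for s
  have e_lim: "(e \<longlongrightarrow> 0) (nhds 0)" and b_lim: "(b \<longlongrightarrow> B y \<tau>) (nhds 0)" and a_lim: "(a \<longlongrightarrow> B \<tau> \<tau>) (nhds 0)"
    unfolding e_def b_def a_def using B.tendsto[OF c0lim c0lim] B.tendsto[OF c0lim t(1)] B.tendsto[OF t(1) t(1)]
      assms(4) by auto
  have "((\<lambda>s. (b s)\<^sup>2 - e s * a s) \<longlongrightarrow> (B y \<tau>)\<^sup>2 - 0 * B \<tau> \<tau>) (nhds 0)"
    by (intro tendsto_intros e_lim b_lim a_lim)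
  then have ev1: "\<forall>\<^sub>F s in nhds 0. 0 < (b s)\<^sup>2 - e s * a s"
    by (rule order_tendstoD(1)) (use \<tau>(2) in simp)
  have ev2: "\<forall>\<^sub>F s in nhds 0. B y \<tau> / 2 < b s" using b_lim by (rule order_tendstoD(1)) (use \<tau>(2) in simp)
  have ev3: "\<forall>\<^sub>F s in nhds 0. norm (t s) < norm \<tau> + 1"
    using tendsto_norm[OF t(1)] by (rule order_tendstoD(2)) simp
  let ?d = "\<lambda>s. x s *\<^sub>R t s"
  have e0: "e 0 = 0" using c0(1) assms(4) by (simp add: e_def)
  have e': "(e has_derivative (\<lambda>_. 0)) (at 0)"
    unfolding e_def[abs_def] using B.FDERIV[OF c0(2) c0(2)] by (simp add: B.zero_left B.zero_right)
  have "\<forall>\<^sub>F s in nhds 0. norm (?d s) \<le> ((norm \<tau> + 1) / (B y \<tau> / 2)) * norm (e s)"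
    using ev1 ev2 ev3
  proof eventually_elim
    case (elim s)
    have "B y \<tau> / 2 \<le> b s + sqrt ((b s)\<^sup>2 - e s * a s)" using elim by (smt (verit) real_sqrt_gt_0_iff)
    then have "\<bar>x s\<bar> \<le> \<bar>e s\<bar> / (B y \<tau> / 2)"
      unfolding x_def abs_divide abs_minus_cancel using \<tau>(2) by (intro frac_le) auto
    then have "\<bar>x s\<bar> * norm (t s) \<le> (\<bar>e s\<bar> / (B y \<tau> / 2)) * (norm \<tau> + 1)"
      using elim(3) \<tau>(2) by (intro mult_mono) auto
    then show ?case by (simp add: algebra_simps)
  qed
  from has_derivative_zero_dominated[OF e' e0 this] have "(?d has_derivative (\<lambda>_. 0)) (at 0)" .
  from has_derivative_add[OF c0(2) this] have c': "((\<lambda>s. c0 s + ?d s) has_derivative (\<lambda>_. 0)) (at 0)" by simp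
  have c_0: "c0 0 + ?d 0 = y" using c0(1) e0 by (simp add: x_def)
  have "((\<lambda>s. c0 s + ?d s) \<longlongrightarrow> y) (nhds 0)"
    using nhds_lim[OF has_derivative_continuous[OF c']] c_0 by simp
  then have "\<forall>\<^sub>F s in nhds 0. c0 s + ?d s \<in> - {0}"
    by (rule topological_tendstoD) (use assms(3) in auto)
  then have "\<forall>\<^sub>F s in nhds 0. ?f s \<in> D \<and> c0 s + ?d s \<in> characteristic B X (?f s)"
    using ev1 ev2 t(2) c0(3)
  proof eventually_elim
    case (elim s)
    define r where "r = sqrt ((b s)\<^sup>2 - e s * a s)"
    have r: "r\<^sup>2 = (b s)\<^sup>2 - e s * a s" "b s + r > 0"
      using elim \<tau>(2) by (auto simp: r_def intro!: add_pos_nonneg)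
    have xr: "x s * (b s + r) = - e s" using r(2) by (simp add: x_def r_def)
    \<comment> \<open>After multiplication by \<open>(b s + r)\<^sup>2\<close> the equation involves
      \<open>x s\<close> only through \<open>x s * (b s + r)\<close>, which is
      \<open>- e s\<close>.\<close>
    have "(a s * (x s)\<^sup>2 + 2 * b s * x s + e s) * (b s + r)\<^sup>2 =
        a s * (x s * (b s + r))\<^sup>2 + 2 * b s * (x s * (b s + r)) * (b s + r) + e s * (b s + r)\<^sup>2"
      by (simp add: power2_eq_square algebra_simps)
    also have "\<dots> = e s * (r\<^sup>2 - ((b s)\<^sup>2 - e s * a s))"
      unfolding xr by (simp add: power2_eq_square algebra_simps)
    also have "\<dots> = 0" using r(1) by simp
    finally have "a s * (x s)\<^sup>2 + 2 * b s * x s + e s = 0" using r(2) by simp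
    moreover have "B (c0 s + ?d s) (c0 s + ?d s) = a s * (x s)\<^sup>2 + 2 * b s * x s + e s"
      using sym[of "t s" "c0 s"]
      by (simp add: a_def b_def e_def B.add_left B.add_right B.scaleR_left B.scaleR_right power2_eq_square algebra_simps)
    moreover have "c0 s + ?d s \<in> P (?f s)"
      using elim plane_subspace by (simp add: subspace_add subspace_scale)
    ultimately show ?case using elim by (simp add: characteristic_def darboux_quadric_def)
  qed
  then show ?thesis using c' c_0 by (intro exI[of _ "\<lambda>s. c0 s + ?d s"]) simp
qed

text \<open>Along the stationary curve given by a kernel vector \<open>v\<close>, each
  \<open>w\<close> in \<open>T\<close> stays tangent to \<open>V\<close> up to o(s). Differentiating
  its orthogonality to \<open>X (u + s v)\<close> yields \<open>B w (dX u v) = 0\<close>; as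
  \<open>T\<close> is orthogonal to \<open>y\<close> and \<open>X u\<close>, and
  \<open>dX u v\<close> is also orthogonal to \<open>P u\<close>, it must be a multiple of
  \<open>X u\<close>.\<close>

lemma regular_characteristic_nonfocal:
  assumes V: "V = (\<Union>u\<in>D. characteristic B X u)" and u: "u \<in> D"
    and y: "y \<in> characteristic B X u" and T: "tangent_space_at V y T" "dim T = DIM('a) - 2"
    and dim2: "DIM('a) \<ge> 2"
    and tangent: "\<And>u y T. u \<in> D \<Longrightarrow> y \<in> characteristic B X u \<Longrightarrow> tangent_space_at V y T \<Longrightarrow>
      dim T = DIM('a) - 2 \<Longrightarrow> T = {W. B W y = 0 \<and> B W (X u) = 0}"
    and pos: "B (X u) (X u) > 0"
    and nondeg: "\<And>z. z \<in> P u \<Longrightarrow> (\<And>w. w \<in> P u \<Longrightarrow> B z w = 0) \<Longrightarrow> z = 0"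
  shows "inj (hess u y)"
  unfolding linear_injective_0[OF hess_linear[OF u]]
proof (intro allI impI)
  fix v assume v: "hess u y v = 0"
  have y': "y \<in> P u" "y \<noteq> 0" "B y y = 0" using y by (auto simp: characteristic_def darboux_quadric_def)
  obtain k N and f :: "nat \<Rightarrow> 'a \<Rightarrow> real" where f: "open N" "y \<in> N" "\<forall>i<k. smooth_on N (f i)"
    "V \<inter> N = {x \<in> N. \<forall>i<k. f i x = 0}" "T = {w. \<forall>i<k. frechet_derivative (f i) (at y) w = 0}"
    "dim T + k = DIM('a)"
    using T(1) unfolding tangent_space_at_def by blast
  \<comment> \<open>The cone over \<open>V\<close> has codimension two in the vector space, hence
    two equations.\<close>
  have k: "k = 2" using f(6) T(2) dim2 by linarith
  have all2: "(\<forall>i<k. Q i) \<longleftrightarrow> Q 0 \<and> Q 1" for Q :: "nat \<Rightarrow> bool"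
    unfolding k by (metis One_nat_def less_2_cases pos2 one_less_numeral_iff semiring_norm(76))
  have Ck: "Ck_on j N (f i)" if "i < k" for i j using f(3) that by (simp add: smooth_on_def)
  define M where "M q w = (frechet_derivative (f 0) (at q) w, frechet_derivative (f 1) (at q) w)" for q w
  have fd: "(f i has_derivative frechet_derivative (f i) (at q)) (at q)" if "i < k" "q \<in> N" for i q
    using Ck_on_Suc_derivative[OF Ck[OF that(1), of "Suc 0"] that(2)] .
  have Mlin: "linear (M q)" if "q \<in> N" for q
    unfolding M_def
    by (rule linearI) (use that fd[of 0 q] fd[of 1 q] k in
        \<open>simp_all add: linear_add[OF has_derivative_linear] linear_scale[OF has_derivative_linear]\<close>)
  have ker: "{w. \<forall>i<k. frechet_derivative (f i) (at q) w = 0} = {w. M q w = 0}" for q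
    by (simp add: all2 M_def zero_prod_def)
  have Tker: "T = {w. M y w = 0}" using f(5) ker by simp
  have surjy: "surj (M y)"
    using dim_kernel_surj[OF Mlin[OF f(2)]] f(6) k by (simp add: Tker)
  have Mdiff: "\<exists>M'. ((\<lambda>q. M q w) has_derivative M') (at y)" for w
  proof -
    have "\<exists>g'. ((\<lambda>q. frechet_derivative (f i) (at q) w) has_derivative g') (at y)" if "i < k" for i
      using Ck_on_Suc_derivative[of 0 N, OF _ f(2)] Ck[OF that, of "Suc (Suc 0)"] by (metis Ck_on.simps(2))
    from this[of 0] this[of 1] show ?thesis unfolding M_def using k by (auto intro: has_derivative_Pair)
  qed
  obtain c where c: "c 0 = y" "(c has_derivative (\<lambda>_. 0)) (at 0)"
    "\<forall>\<^sub>F s in nhds 0. u + s *\<^sub>R v \<in> D \<and> c s \<in> characteristic B X (u + s *\<^sub>R v)"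
    using null_curve[OF u y' v nondeg] by blast
  have "isCont c 0" using has_derivative_continuous[OF c(2)] .
  then have clim: "(c \<longlongrightarrow> y) (nhds 0)" using c(1) tendsto_at_iff_tendsto_nhds[of c 0] by (simp add: isCont_def)
  have cN: "\<forall>\<^sub>F s in nhds 0. c s \<in> N" using topological_tendstoD[OF clim f(1,2)] .
  have "\<exists>C>0. \<forall>\<^sub>F s in nhds 0. \<forall>z. \<exists>d. M (c s) d = z \<and> norm d \<le> C * norm z"
  proof (rule surj_perturbation[OF _ Mlin[OF f(2)] surjy])
    show "\<forall>\<^sub>F s in nhds 0. linear (M (c s))" using cN by eventually_elim (rule Mlin)
    show "((\<lambda>s. M (c s) z) \<longlongrightarrow> M y z) (nhds 0)" for z
      using Mdiff[of z] has_derivative_continuous isCont_tendsto_compose[OF _ clim] by blast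
  qed
  then obtain C where C: "\<forall>\<^sub>F s in nhds 0. \<forall>z. \<exists>d. M (c s) d = z \<and> norm d \<le> C * norm z" by blast
  have ortho: "B w (dX u v) = 0" if w: "w \<in> T" for w
  proof -
    \<comment> \<open>Surjectivity of \<open>M (c s)\<close> corrects \<open>w\<close> to a vector
      of the tangent space at \<open>c s\<close>, which is regular again and so is orthogonal to
      \<open>X (u + s v)\<close>.\<close>
    have "\<forall>\<^sub>F s in nhds 0. \<exists>d. B (w - d) (X (u + s *\<^sub>R v)) = 0 \<and> norm d \<le> C * norm (M (c s) w)"
      using C cN c(3)
    proof eventually_elim
      case (elim s)
      have "surj (M (c s))" using elim(1) by (metis surjI)
      then have dimk: "dim {w. M (c s) w = 0} + 2 = DIM('a)"
        using dim_kernel_surj[OF Mlin[OF elim(2)]] by simp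
      have "tangent_space_at V (c s) {w. M (c s) w = 0}"
        unfolding tangent_space_at_def
      proof (intro conjI exI)
        show "c s \<in> V" using elim(3) by (auto simp: V)
        show "{w. M (c s) w = 0} = {w. \<forall>i<k. frechet_derivative (f i) (at (c s)) w = 0}" using ker by simp
        show "dim {w. M (c s) w = 0} + k = DIM('a)" using dimk k by simp
      qed (fact f elim)+
      then have eq: "{w. M (c s) w = 0} = {w. B w (c s) = 0 \<and> B w (X (u + s *\<^sub>R v)) = 0}"
        using tangent[of "u + s *\<^sub>R v" "c s"] elim dimk by simp
      obtain d where d: "M (c s) d = M (c s) w" "norm d \<le> C * norm (M (c s) w)" using elim(1) by blast
      then have "M (c s) (w - d) = 0" by (simp add: linear_diff[OF Mlin[OF elim(2)]])
      then show ?case using eq d(2) by blast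
    qed
    then obtain d where d: "\<forall>\<^sub>F s in nhds 0. B (w - d s) (X (u + s *\<^sub>R v)) = 0 \<and> norm (d s) \<le> C * norm (M (c s) w)"
      unfolding eventually_ex by blast
    obtain M' where M': "((\<lambda>q. M q w) has_derivative M') (at y)" using Mdiff by blast
    have "((\<lambda>s. M (c s) w) has_derivative (\<lambda>s. M' 0)) (at 0)"
      using has_derivative_compose[OF c(2), of "\<lambda>q. M q w" M'] M' c(1) by simp
    then have M0: "((\<lambda>s. M (c s) w) has_derivative (\<lambda>_. 0)) (at 0)"
      using linear_0[OF has_derivative_linear[OF M']] by simp
    have "M (c 0) w = 0" using w c(1) Tker by simp
    moreover have "\<forall>\<^sub>F s in nhds 0. norm (d s) \<le> C * norm (M (c s) w)"
      using d by eventually_elim simp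
    ultimately have d': "(d has_derivative (\<lambda>_. 0)) (at 0)"
      by (rule has_derivative_zero_dominated[OF M0])
    have d0: "d 0 = 0" using eventually_nhds_x_imp_x[OF d] \<open>M (c 0) w = 0\<close> by simp
    have "((\<lambda>s. u + s *\<^sub>R v) has_derivative (\<lambda>s. s *\<^sub>R v)) (at 0)" by (auto intro!: derivative_eq_intros)
    from has_derivative_compose[OF this, of X "dX u"] has_derivative_X[OF u]
    have "((\<lambda>s. X (u + s *\<^sub>R v)) has_derivative (\<lambda>s. dX u (s *\<^sub>R v))) (at 0)" by simp
    from B.FDERIV[OF has_derivative_diff[OF has_derivative_const[of w] d'] this]
    have D: "((\<lambda>s. B (w - d s) (X (u + s *\<^sub>R v))) has_derivative (\<lambda>s. B w (dX u (s *\<^sub>R v)))) (at 0)"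
      by (simp add: d0 B.zero_left)
    have d_at: "\<forall>\<^sub>F s in at 0. B (w - d s) (X (u + s *\<^sub>R v)) = 0"
      using filter_leD[OF at_within_le_nhds d] by eventually_elim simp
    have "B (w - d 0) (X (u + 0 *\<^sub>R v)) = 0" using eventually_nhds_x_imp_x[OF d] by blast
    from has_derivative_transform_eventually[OF D d_at this]
    have "((\<lambda>s. 0) has_derivative (\<lambda>s. B w (dX u (s *\<^sub>R v)))) (at (0::real))" by simp
    from has_derivative_unique[OF this has_derivative_const] have "B w (dX u (1 *\<^sub>R v)) = 0" by metis
    then show ?thesis by simp
  qed
  obtain \<tau> where \<tau>: "\<tau> \<in> P u" "B y \<tau> \<noteq> 0" using nondeg[OF y'(1)] y'(2) by blast
  define \<alpha> where "\<alpha> = B (dX u v) (X u) / B (X u) (X u)"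
  have "B (dX u v - \<alpha> *\<^sub>R X u) z = 0" for z
  proof -
    \<comment> \<open>The projection of an arbitrary \<open>z\<close> into \<open>T\<close> along
      \<open>X u\<close> and \<open>\<tau>\<close>; the choice of \<open>\<alpha>\<close> accounts
      for the \<open>X u\<close> term, and \<open>\<tau>\<close> is orthogonal to
      \<open>dX u v\<close>.\<close>
    define w where "w = z - (B z (X u) / B (X u) (X u)) *\<^sub>R X u - (B z y / B \<tau> y) *\<^sub>R \<tau>"
    have o: "B \<tau> (X u) = 0" "B y (X u) = 0" "B \<tau> (dX u v) = 0" "B \<tau> y \<noteq> 0"
      using plane_orthogonal[OF \<tau>(1)] plane_orthogonal[OF y'(1)] u \<tau>(2) sym by auto
    have "B w y = 0" "B w (X u) = 0"
      using o pos sym[of "X u" y] by (simp_all add: w_def B.diff_left B.scaleR_left)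
    then have "w \<in> T" using tangent[OF u y T] by blast
    then have "B w (dX u v) = 0" by (rule ortho)
    then show ?thesis
      using o by (simp add: w_def \<alpha>_def B.diff_left B.scaleR_left sym[of "dX u v" z] sym[of "X u" z] sym[of "X u" "dX u v"])
  qed
  then have "dX u v - \<alpha> *\<^sub>R X u = 0" by (rule nondegenerate)
  then show "v = 0" using immersion[OF u, of v \<alpha>] by simp
qed

end

section \<open>Subfamilies and the conclusion\<close>

lemma (in enveloping_family) restrict_parameters:
  assumes "open D'" "D' \<subseteq> D"
  shows "enveloping_family B D' X"
proof
  show "smooth_on D' X" using smooth assms(2) unfolding smooth_on_def by (blast intro: Ck_on_subset)
qed (use assms bilinear sym nondegenerate X_nonzero immersion nonfocal in blast)+

text \<open>Tangential degeneracy constrains regular points only. The second conjunct therefore adds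
  that every sufficiently small subfamily has an image with regular points on a generator through
  each of its points.\<close>

theorem theorem5:
  fixes B :: "'a::euclidean_space \<Rightarrow> 'a \<Rightarrow> real"
    and X :: "'b::euclidean_space \<Rightarrow> 'a"
    and D :: "'b set" and V :: "'a set"
    and n m :: nat
  assumes "DIM('a) = n + 2"
    and "bilinear B" and "\<forall>x y. B x y = B y x" and "has_signature B UNIV (n + 1) 1"
    and "1 \<le> m" and "m \<le> n - 2"
    and "DIM('b) = n - m - 1"
    and "canal_hypersurface B m D X V"
  shows
    "(tangentially_degenerate (darboux_image B D X) (n - m - 1) \<and>
      (\<forall>p \<in> darboux_image B D X. \<exists>L. plane_generator (darboux_image B D X) (m + 1) L \<and> p \<in> L)) \<and>
     (\<forall>u\<in>D. \<exists>D0. open D0 \<and> u \<in> D0 \<and> D0 \<subseteq> D \<and>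
        (\<forall>D'. open D' \<and> D' \<noteq> {} \<and> D' \<subseteq> D0 \<longrightarrow>
           tangentially_degenerate (darboux_image B D' X) (n - m - 1) \<and>
           (\<forall>p \<in> darboux_image B D' X. \<exists>L. plane_generator (darboux_image B D' X) (m + 1) L \<and>
              p \<in> L \<and> L \<inter> hypersurface_points (darboux_image B D' X) \<noteq> {})))"
proof -
  have sym: "B x y = B y x" for x y using assms(3) by blast
  have family: "open D" "smooth_on D X" "\<And>u. u \<in> D \<Longrightarrow> B (X u) (X u) > 0"
    "\<And>u v c. u \<in> D \<Longrightarrow> frechet_derivative X (at u) v = c *\<^sub>R X u \<Longrightarrow> v = 0"
    using assms(8) unfolding canal_hypersurface_def hypersphere_family_def by blast+
  have V: "V = (\<Union>u\<in>D. characteristic B X u)"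
    and sign: "\<And>u. u \<in> D \<Longrightarrow> has_signature B (characteristic_plane B X u) (m + 1) 1"
    and reg: "\<And>u. u \<in> D \<Longrightarrow> characteristic B X u \<inter> regular_points (DIM('a) - 2) V \<noteq> {}"
    and tang: "\<And>u Y T. u \<in> D \<Longrightarrow> Y \<in> characteristic B X u \<Longrightarrow> tangent_space_at V Y T \<Longrightarrow>
      dim T = DIM('a) - 2 \<Longrightarrow> T = {W. B W Y = 0 \<and> B W (X u) = 0}"
    using assms(8) unfolding canal_hypersurface_def by blast+
  interpret plane_family B D X
  proof
    show "x = 0" if "\<And>y. B x y = 0" for x
      by (rule has_signature_nondegenerate[OF assms(4,2) sym UNIV_I that])
    show "X u \<noteq> 0" if "u \<in> D" for u using family(3)[OF that] bilinear_lzero[OF assms(2)] by force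
  qed (use assms(2) sym family in blast)+
  have "\<exists>q\<in>P u. inj (hess u q)" if u: "u \<in> D" for u
  proof -
    obtain y T where y: "y \<in> characteristic B X u" and T: "tangent_space_at V y T" "dim T = DIM('a) - 2"
      using reg[OF u] by (auto simp: regular_points_def)
    have "inj (hess u y)"
      by (rule regular_characteristic_nonfocal[OF V u y T _ tang family(3)[OF u]])
        (use assms(1) has_signature_nondegenerate[OF sign[OF u] assms(2) sym] in auto)
    then show ?thesis using y by (auto simp: characteristic_def)
  qed
  then interpret enveloping_family B D X by unfold_locales
  \<comment> \<open>The count is \<open>(m + 2) + 1 + (n - m - 1) = n + 2\<close>; a projective
    plane of dimension \<open>m + 1\<close> is a linear subspace of dimension
    \<open>m + 2\<close>.\<close>
  have dimP: "dim (P u) = m + 1 + 1" if "u \<in> D" for u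
    using dim_plane[OF that] assms(1,5-7) by linarith
  \<comment> \<open>Stated for all open subfamilies, so that it serves both conjuncts; the planes
    \<open>P u\<close> are independent of the parameter set.\<close>
  have main: "tangentially_degenerate (darboux_image B D' X) (n - m - 1) \<and>
      (\<forall>u\<in>D'. plane_generator (darboux_image B D' X) (m + 1) (P u))"
    if D': "open D'" "D' \<subseteq> D" for D'
  proof -
    interpret sub: enveloping_family B D' X using restrict_parameters[OF D'] .
    have "tangentially_degenerate (darboux_image B D' X) (n - m - 1)"
      using sub.tangentially_degenerate_image assms(1,5-7) by simp
    moreover have "plane_generator (darboux_image B D' X) (m + 1) (P u)" if "u \<in> D'" for u
      using sub.plane_generator_image[OF that dimP] that D' by blast
    ultimately show ?thesis by blast
  qed
  have mem: "\<exists>u\<in>D'. p \<in> P u" if "p \<in> darboux_image B D' X" for p D'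
    using that by (auto simp: darboux_image_def)
  have "\<exists>D0. open D0 \<and> u \<in> D0 \<and> D0 \<subseteq> D \<and>
        (\<forall>D'. open D' \<and> D' \<noteq> {} \<and> D' \<subseteq> D0 \<longrightarrow>
           tangentially_degenerate (darboux_image B D' X) (n - m - 1) \<and>
           (\<forall>p \<in> darboux_image B D' X. \<exists>L. plane_generator (darboux_image B D' X) (m + 1) L \<and>
              p \<in> L \<and> L \<inter> hypersurface_points (darboux_image B D' X) \<noteq> {}))" if u: "u \<in> D" for u
  proof -
    obtain q where q: "q \<in> P u" "inj (hess u q)" using nonfocal[OF u] by blast
    obtain D0 where D0: "open D0" "u \<in> D0" "D0 \<subseteq> D" and
      D0': "\<forall>D'. open D' \<and> D' \<subseteq> D0 \<longrightarrow>
        (\<forall>u\<in>D'. P u \<inter> hypersurface_points (darboux_image B D' X) \<noteq> {})"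
      using locally_regular_points[OF u q] by (elim exE conjE) (rule that)
    show ?thesis
    proof (intro exI[of _ D0] conjI allI impI ballI D0(1-3))
      fix D' assume D': "open D' \<and> D' \<noteq> {} \<and> D' \<subseteq> D0"
      then have sub: "open D'" "D' \<subseteq> D" using D0(3) by auto
      show "tangentially_degenerate (darboux_image B D' X) (n - m - 1)" using main[OF sub] by blast
      fix p assume "p \<in> darboux_image B D' X"
      then obtain v where v: "v \<in> D'" "p \<in> P v" using mem by blast
      have "plane_generator (darboux_image B D' X) (m + 1) (P v)" using main[OF sub] v(1) by blast
      moreover have "P v \<inter> hypersurface_points (darboux_image B D' X) \<noteq> {}" using D0' D' v(1) by blast
      ultimately show "\<exists>L. plane_generator (darboux_image B D' X) (m + 1) L \<and>
          p \<in> L \<and> L \<inter> hypersurface_points (darboux_image B D' X) \<noteq> {}"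
        using v(2) by blast
    qed
  qed
  moreover have "\<exists>L. plane_generator (darboux_image B D X) (m + 1) L \<and> p \<in> L"
    if "p \<in> darboux_image B D X" for p
    using main[OF open_D subset_refl] mem[OF that] by blast
  ultimately show ?thesis using main[OF open_D subset_refl] by blast
qed

end
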